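(* For any spinor polynomial $P\in\mathrm{CGA}_+[t]$ there exists a spinor polynomial $H\in\mathrm{CGA}_+[t]$ such that $PH$ admits a factorization with linear factors. Moreover, there exists a real polynomial $R\in\mathbb{R}[t]$, $R \neq 0$, such that $PR$ admits a factorization with linear factors.
   Context: $\mathrm{CGA}$ is the real Clifford algebra $\mathcal{C}\ell(4,1)$ generated by anti-commuting elements $e_1,e_2,e_3,e_+,e_-$ with $e_1^2=e_2^2=e_3^2=e_+^2=1$, $e_-^2=-1$; $\mathrm{CGA}_+$ is its even sub-algebra. The reverse $\widetilde{q}$ is the linear anti-automorphism reversing the order of products of the generators. In $\mathrm{CGA}_+[t]$ the indeterminate $t$ commutes with all coefficients, and for $C=\sum t^i q_i$ one puts $\widetilde{C}=\sum t^i\widetilde{q}_i$. A polynomial $C\in\mathrm{CGA}_+[t]$ is a spinor polynomial if $C\widetilde{C}=\widetilde{C}C\in\mathbb{R}[t]\setminus\{0\}$. A factorization with linear factors is a representation as a product of finitely many spinor polynomials of degree one in $\mathrm{CGA}_+[t]$. *)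

theory Defs
  imports Complex_Main "HOL-Library.Poly_Mapping"
begin

section \<open>The Clifford algebra with signature (4,1)\<close>

datatype gen = G1 | G2 | G3 | Gplus | Gminus

lemma UNIV_gen: "UNIV = {G1, G2, G3, Gplus, Gminus}"
  using gen.exhaust by auto

instance gen :: finite
  by standard (simp add: UNIV_gen)

primrec gen_rank :: "gen \<Rightarrow> nat" where
  "gen_rank G1 = 0"
| "gen_rank G2 = 1"
| "gen_rank G3 = 2"
| "gen_rank Gplus = 3"
| "gen_rank Gminus = 4"

lemma gen_rank_inject: "gen_rank a = gen_rank b \<longleftrightarrow> a = b"
  by (cases a; cases b) simp_all

instantiation gen :: linorder
begin
definition "a \<le> b \<longleftrightarrow> gen_rank a \<le> gen_rank b"
definition "a < b \<longleftrightarrow> gen_rank a < gen_rank b"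
instance
  by standard (auto simp: less_eq_gen_def less_gen_def gen_rank_inject)
end

definition gen_square :: "gen \<Rightarrow> real" where
  "gen_square a = (if a = Gminus then -1 else 1)"

text \<open>
  A multivector is given by its coordinates with respect to the 32 basis blades. The blade of a set
  \<open>A\<close> of generators is the product of the elements of \<open>A\<close> in increasing order. The product of the
  blades of \<open>A\<close> and \<open>B\<close> is \<open>blade_sign A B\<close> times the blade of \<open>sym_diff A B\<close>: each pair
  \<open>a \<in> A\<close>, \<open>b \<in> B\<close> with \<open>b < a\<close> costs one transposition, and each common generator contributes its
  square.
\<close>

definition swap_sign :: "gen \<Rightarrow> gen \<Rightarrow> real" where
  "swap_sign a b = (if b < a then -1 else if a = b then gen_square a else 1)"

definition blade_sign :: "gen set \<Rightarrow> gen set \<Rightarrow> real" where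
  "blade_sign A B = (\<Prod>a\<in>A. \<Prod>b\<in>B. swap_sign a b)"

lemma swap_sign_square [simp]: "swap_sign a b * swap_sign a b = 1"
  by (simp add: swap_sign_def gen_square_def)

lemma prod_sym_diff:
  fixes f :: "gen \<Rightarrow> real"
  assumes "\<And>a. f a * f a = 1"
  shows "prod f (sym_diff A B) = prod f A * prod f B"
proof -
  have s: "prod f (A \<inter> B) * prod f (A \<inter> B) = 1"
    by (simp add: assms flip: prod.distrib)
  have A: "prod f A = prod f (A - B) * prod f (A \<inter> B)"
    by (subst prod.union_disjoint [symmetric]) (auto intro: arg_cong [of _ _ "prod f"])
  have B: "prod f B = prod f (B - A) * prod f (A \<inter> B)"
    by (subst prod.union_disjoint [symmetric]) (auto intro: arg_cong [of _ _ "prod f"])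
  have "prod f (sym_diff A B) = prod f (A - B) * prod f (B - A)"
    by (rule prod.union_disjoint) auto
  then show ?thesis
    using s unfolding A B by (simp add: mult_ac)
qed

lemma prod_square_one:
  fixes f :: "gen \<Rightarrow> real"
  assumes "\<And>a. f a * f a = 1"
  shows "prod f A * prod f A = 1"
  by (simp add: assms flip: prod.distrib)

lemma blade_sign_square [simp]: "blade_sign A B * blade_sign A B = 1"
  unfolding blade_sign_def by (intro prod_square_one swap_sign_square)

lemma blade_sign_sym_diff_left:
  "blade_sign (sym_diff A B) C = blade_sign A C * blade_sign B C"
  unfolding blade_sign_def by (intro prod_sym_diff prod_square_one swap_sign_square)

lemma blade_sign_sym_diff_right:
  "blade_sign A (sym_diff B C) = blade_sign A B * blade_sign A C"
proof -
  have "blade_sign A (sym_diff B C) =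
      (\<Prod>a\<in>A. (\<Prod>b\<in>B. swap_sign a b) * (\<Prod>b\<in>C. swap_sign a b))"
    unfolding blade_sign_def by (intro prod.cong refl prod_sym_diff swap_sign_square)
  then show ?thesis
    by (simp add: blade_sign_def prod.distrib)
qed

lemma blade_sign_empty [simp]: "blade_sign {} A = 1" "blade_sign A {} = 1"
  by (simp_all add: blade_sign_def)

typedef cga = "UNIV :: (gen set \<Rightarrow> real) set"
  morphisms coord Abs_cga ..

setup_lifting type_definition_cga

lemma cga_eqI: "(\<And>A. coord x A = coord y A) \<Longrightarrow> x = y"
  by transfer auto

lift_definition blade :: "gen set \<Rightarrow> cga" is "\<lambda>A B. if A = B then 1 else 0" .

definition gen :: "gen \<Rightarrow> cga" where
  "gen a = blade {a}"

lemma sym_diff_cancel [simp]: "sym_diff A (sym_diff A B) = B"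
  by auto

lemma sym_diff_bij: "bij (\<lambda>B. sym_diff A B)"
  by (rule bij_betw_byWitness [where f' = "\<lambda>B. sym_diff A B"]) auto

instantiation cga :: real_algebra_1
begin

lift_definition zero_cga :: cga is "\<lambda>_. 0" .
lift_definition one_cga :: cga is "\<lambda>A. if A = {} then 1 else 0" .
lift_definition plus_cga :: "cga \<Rightarrow> cga \<Rightarrow> cga" is "\<lambda>x y A. x A + y A" .
lift_definition minus_cga :: "cga \<Rightarrow> cga \<Rightarrow> cga" is "\<lambda>x y A. x A - y A" .
lift_definition uminus_cga :: "cga \<Rightarrow> cga" is "\<lambda>x A. - x A" .
lift_definition scaleR_cga :: "real \<Rightarrow> cga \<Rightarrow> cga" is "\<lambda>r x A. r * x A" .

text \<open>For given \<open>A\<close>, the set \<open>sym_diff A C\<close> is the only \<open>B\<close> with \<open>sym_diff A B = C\<close>.\<close>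

lift_definition times_cga :: "cga \<Rightarrow> cga \<Rightarrow> cga" is
  "\<lambda>x y C. \<Sum>A\<in>UNIV. blade_sign A (sym_diff A C) * x A * y (sym_diff A C)" .

instance
proof
  fix x y z :: cga and r s :: real
  show "x + y + z = x + (y + z)" by transfer auto
  show "x + y = y + x" by transfer auto
  show "0 + x = x" by transfer auto
  show "- x + x = 0" by transfer auto
  show "x - y = x + - y" by transfer auto
  show "r *\<^sub>R (x + y) = r *\<^sub>R x + r *\<^sub>R y" by transfer (auto simp: algebra_simps)
  show "(r + s) *\<^sub>R x = r *\<^sub>R x + s *\<^sub>R x" by transfer (auto simp: algebra_simps)
  show "r *\<^sub>R s *\<^sub>R x = (r * s) *\<^sub>R x" by transfer (auto simp: algebra_simps)
  show "1 *\<^sub>R x = x" by transfer auto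
  show "(0::cga) \<noteq> 1" by transfer (auto simp: fun_eq_iff)
  show "(x + y) * z = x * z + y * z"
    by transfer (auto simp: algebra_simps sum.distrib)
  show "x * (y + z) = x * y + x * z"
    by transfer (auto simp: algebra_simps sum.distrib)
  show "r *\<^sub>R x * y = r *\<^sub>R (x * y)"
    by transfer (auto simp: algebra_simps sum_distrib_left)
  show "x * r *\<^sub>R y = r *\<^sub>R (x * y)"
    by transfer (auto simp: algebra_simps sum_distrib_left)
  show "1 * x = x"
  proof (transfer, rule ext)
    fix x :: "gen set \<Rightarrow> real" and C :: "gen set"
    have "(\<Sum>A\<in>UNIV. blade_sign A (sym_diff A C) * (if A = {} then 1 else 0) * x (sym_diff A C))
        = (\<Sum>A\<in>(UNIV :: gen set set). if A = {} then x C else 0)"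
      by (rule sum.cong [OF refl]) auto
    then show "(\<Sum>A\<in>UNIV. blade_sign A (sym_diff A C) * (if A = {} then 1 else 0) *
        x (sym_diff A C)) = x C"
      by simp
  qed
  show "x * 1 = x"
  proof (transfer, rule ext)
    fix x :: "gen set \<Rightarrow> real" and C :: "gen set"
    have *: "sym_diff A C = {} \<longleftrightarrow> A = C" for A
      by auto
    have "(\<Sum>A\<in>UNIV. blade_sign A (sym_diff A C) * x A * (if sym_diff A C = {} then 1 else 0))
        = (\<Sum>A\<in>UNIV. if A = C then x A else 0)"
      unfolding * by (rule sum.cong [OF refl]) auto
    then show "(\<Sum>A\<in>UNIV. blade_sign A (sym_diff A C) * x A *
        (if sym_diff A C = {} then 1 else 0)) = x C"
      by simp
  qed
  show "x * y * z = x * (y * z)"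
  proof (transfer, rule ext)
    fix x y z :: "gen set \<Rightarrow> real" and D
    let ?s = blade_sign and ?d = sym_diff
    have sgn: "?s C (?d C D) * ?s A (?d A C) = ?s A (?d A D) * ?s (?d A C) (?d C D)" for A C
    proof -
      have eq: "?d A D = ?d (?d A C) (?d C D)"
        by auto
      have "?s A (?d A D) * ?s (?d A C) (?d C D)
          = ?s A (?d A C) * (?s A (?d C D) * ?s A (?d C D)) * ?s C (?d C D)"
        by (subst eq, subst blade_sign_sym_diff_right, subst blade_sign_sym_diff_left)
          (simp only: mult_ac)
      then show ?thesis
        by (simp add: mult_ac)
    qed
    have inner: "(\<Sum>B\<in>UNIV. ?s B (?d B (?d A D)) * y B * z (?d B (?d A D)))
        = (\<Sum>C\<in>UNIV. ?s (?d A C) (?d C D) * y (?d A C) * z (?d C D))" for A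
    proof -
      have eq: "?d (?d A C) (?d A D) = ?d C D" for C
        by auto
      show ?thesis
        by (subst sum.reindex_bij_betw [OF sym_diff_bij [of A], symmetric]) (simp only: eq)
    qed
    have "(\<Sum>C\<in>UNIV. ?s C (?d C D) * (\<Sum>A\<in>UNIV. ?s A (?d A C) * x A * y (?d A C)) * z (?d C D))
        = (\<Sum>C\<in>UNIV. \<Sum>A\<in>UNIV. (?s C (?d C D) * ?s A (?d A C)) * x A * y (?d A C) * z (?d C D))"
      by (simp only: sum_distrib_left sum_distrib_right mult.assoc)
    also have "\<dots> = (\<Sum>A\<in>UNIV. \<Sum>C\<in>UNIV.
        ?s A (?d A D) * x A * (?s (?d A C) (?d C D) * y (?d A C) * z (?d C D)))"
      by (subst sum.swap) (simp only: sgn mult_ac)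
    also have "\<dots> = (\<Sum>A\<in>UNIV. ?s A (?d A D) * x A *
        (\<Sum>B\<in>UNIV. ?s B (?d B (?d A D)) * y B * z (?d B (?d A D))))"
      by (simp only: inner sum_distrib_left)
    finally show "(\<Sum>C\<in>UNIV. ?s C (?d C D) *
          (\<Sum>A\<in>UNIV. ?s A (?d A C) * x A * y (?d A C)) * z (?d C D))
        = (\<Sum>A\<in>UNIV. ?s A (?d A D) * x A *
          (\<Sum>B\<in>UNIV. ?s B (?d B (?d A D)) * y B * z (?d B (?d A D))))" .
  qed
qed

end

lemma coord_simps [simp]:
  "coord 0 A = 0" "coord (x + y) A = coord x A + coord y A"
  "coord (x - y) A = coord x A - coord y A" "coord (- x) A = - coord x A"
  "coord (r *\<^sub>R x) A = r * coord x A" "coord 1 A = (if A = {} then 1 else 0)"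
  by (transfer, simp)+

lemma coord_sum [simp]: "coord (sum f I) A = (\<Sum>i\<in>I. coord (f i) A)"
  by (induction I rule: infinite_finite_induct) auto

lemma coord_times:
  "coord (x * y) C = (\<Sum>A\<in>UNIV. blade_sign A (sym_diff A C) * coord x A * coord y (sym_diff A C))"
  by transfer simp

lemma coord_blade [simp]: "coord (blade A) B = (if A = B then 1 else 0)"
  by transfer simp

lemma cga_expand: "x = (\<Sum>A\<in>UNIV. coord x A *\<^sub>R blade A)"
proof (rule cga_eqI)
  fix B
  have "(\<Sum>A\<in>UNIV. coord x A * (if A = B then 1 else 0)) = (\<Sum>A\<in>UNIV. if A = B then coord x A else 0)"
    by (rule sum.cong [OF refl]) auto
  then show "coord x B = coord (\<Sum>A\<in>UNIV. coord x A *\<^sub>R blade A) B"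
    by simp
qed

lemma blade_empty [simp]: "blade {} = 1"
  by (rule cga_eqI) auto

lemma blade_times_blade: "blade A * blade B = blade_sign A B *\<^sub>R blade (sym_diff A B)"
proof (rule cga_eqI)
  fix C
  have eq: "B = sym_diff A C \<longleftrightarrow> sym_diff A B = C"
    by auto
  have "coord (blade A * blade B) C =
      (\<Sum>A'\<in>UNIV. if A' = A then (if B = sym_diff A C then blade_sign A B else 0) else 0)"
    unfolding coord_times by (rule sum.cong [OF refl]) auto
  also have "\<dots> = (if sym_diff A B = C then blade_sign A B else 0)"
    by (simp add: eq)
  finally show "coord (blade A * blade B) C = coord (blade_sign A B *\<^sub>R blade (sym_diff A B)) C"
    by simp
qed

lemma gen_mult_self: "gen a * gen a = gen_square a *\<^sub>R 1"
  by (simp add: gen_def blade_times_blade blade_sign_def swap_sign_def)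

lemma gen_anticommute: "a \<noteq> b \<Longrightarrow> gen a * gen b = - (gen b * gen a)"
  by (cases "a < b") (auto simp: gen_def blade_times_blade blade_sign_def swap_sign_def insert_commute Un_commute)

lemma blade_insert_less:
  assumes less: "\<And>b. b \<in> A \<Longrightarrow> a < b"
  shows "blade (insert a A) = gen a * blade A"
proof -
  have "blade_sign {a} A = 1"
    using less by (fastforce simp: blade_sign_def swap_sign_def intro!: prod.neutral dest: less_asym)
  moreover have "sym_diff {a} A = insert a A"
    using less by auto
  ultimately show ?thesis
    by (simp add: gen_def blade_times_blade)
qed

lemma blade_eq_prod_list: "blade A = prod_list (map gen (sorted_list_of_set A))"
proof -
  have "blade (set xs) = prod_list (map gen xs)" if "sorted xs" "distinct xs" for xs
    using that
  proof (induction xs)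
    case (Cons a xs)
    then have "a < b" if "b \<in> set xs" for b
      using that by (auto simp: less_le)
    with Cons show ?case
      by (simp add: blade_insert_less)
  qed simp
  from this [of "sorted_list_of_set A"] show ?thesis
    by simp
qed

text \<open>Reversing a product of \<open>k\<close> distinct generators takes \<open>k choose 2\<close> transpositions.\<close>

lift_definition reverse :: "cga \<Rightarrow> cga" is "\<lambda>x A. (-1) ^ (card A choose 2) * x A" .

lemma coord_reverse [simp]: "coord (reverse x) A = (-1) ^ (card A choose 2) * coord x A"
  by transfer simp

lemma reverse_linear [simp]:
  "reverse 0 = 0" "reverse (x + y) = reverse x + reverse y" "reverse (r *\<^sub>R x) = r *\<^sub>R reverse x"
  by (rule cga_eqI; simp add: algebra_simps)+

lemma reverse_sum: "reverse (sum f I) = (\<Sum>i\<in>I. reverse (f i))"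
  by (induction I rule: infinite_finite_induct) auto

lemma reverse_gen [simp]: "reverse (gen a) = gen a"
  by (rule cga_eqI) (auto simp: gen_def binomial_eq_0)

lemma reverse_one [simp]: "reverse 1 = 1"
  by (rule cga_eqI) (auto simp: numeral_2_eq_2)

lemma blade_sign_commute:
  "blade_sign A B * blade_sign B A = (-1) ^ (card A * card B + card (A \<inter> B))"
proof -
  have sw: "swap_sign a b * swap_sign b a = - (if a = b then -1 else 1)" for a b
    by (auto simp: swap_sign_def gen_square_def)
  have row: "(\<Prod>b\<in>B. - (if a = b then -1 else 1 :: real))
      = (-1) ^ card B * (if a \<in> B then -1 else 1)" for a
    by (subst prod_uminus) (simp add: prod.If_cases)
  have "blade_sign B A = (\<Prod>a\<in>A. \<Prod>b\<in>B. swap_sign b a)"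
    unfolding blade_sign_def by (rule prod.swap)
  then have "blade_sign A B * blade_sign B A = (\<Prod>a\<in>A. \<Prod>b\<in>B. swap_sign a b * swap_sign b a)"
    by (simp add: blade_sign_def prod.distrib)
  also have "\<dots> = (\<Prod>a\<in>A. (-1) ^ card B * (if a \<in> B then -1 else 1))"
    unfolding sw row ..
  also have "\<dots> = (-1) ^ (card A * card B + card (A \<inter> B))"
    by (simp add: prod.distrib prod.If_cases power_add mult.commute flip: power_mult)
  finally show ?thesis .
qed

lemma reverse_sign:
  "(-1) ^ (card (sym_diff A B) choose 2) * blade_sign A B
    = ((-1) ^ (card A choose 2) * (-1) ^ (card B choose 2) :: real) * blade_sign B A"
proof -
  define a b c where "a = card (A - B)" and "b = card (B - A)" and "c = card (A \<inter> B)"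
  have A: "card A = a + c" and B: "card B = b + c" and AB: "card (sym_diff A B) = a + b"
    unfolding a_def b_def c_def
    by (subst card_Un_disjoint [symmetric]; auto intro: arg_cong [of _ _ card])+
  have add: "(m + n choose 2) = (m choose 2) + (n choose 2) + m * n" for m n :: nat
    by (induction n) (auto simp: numeral_2_eq_2)
  have par: "even ((a + b choose 2) + ((a + c) * (b + c) + c))
      \<longleftrightarrow> even ((a + c choose 2) + (b + c choose 2))"
    by (auto simp: add)
  have "(-1) ^ (a + b choose 2) * (-1) ^ ((a + c) * (b + c) + c)
      = ((-1) ^ (a + c choose 2) * (-1) ^ (b + c choose 2) :: real)"
    unfolding power_add [symmetric] unfolding minus_one_power_iff par ..
  then have *: "(-1) ^ (card (sym_diff A B) choose 2) * (blade_sign A B * blade_sign B A)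
      = ((-1) ^ (card A choose 2) * (-1) ^ (card B choose 2) :: real)"
    by (simp add: blade_sign_commute A B AB flip: c_def)
  show ?thesis
    unfolding * [symmetric] by (simp add: mult.assoc)
qed

lemma reverse_blade: "reverse (blade A) = (-1) ^ (card A choose 2) *\<^sub>R blade A"
  by (rule cga_eqI) auto

lemma reverse_mult: "reverse (x * y) = reverse y * reverse x"
proof -
  have bl: "reverse (blade A * blade B) = reverse (blade B) * reverse (blade A)" for A B
    using reverse_sign [of A B]
    by (simp add: blade_times_blade reverse_blade Un_commute mult_ac)
  have "reverse ((\<Sum>A\<in>UNIV. coord x A *\<^sub>R blade A) * (\<Sum>B\<in>UNIV. coord y B *\<^sub>R blade B))
      = reverse (\<Sum>B\<in>UNIV. coord y B *\<^sub>R blade B) * reverse (\<Sum>A\<in>UNIV. coord x A *\<^sub>R blade A)"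
    unfolding sum_product reverse_sum
    by (subst (2) sum.swap) (simp add: bl mult.commute)
  then show ?thesis
    by (simp flip: cga_expand)
qed

lemma reverse_prod_list_gen:
  "reverse (prod_list (map gen as)) = prod_list (map gen (rev as))"
  by (induction as) (simp_all add: reverse_mult)

definition cga_even :: "cga set" where
  "cga_even = {x. \<forall>A. odd (card A) \<longrightarrow> coord x A = 0}"

lemma even_card_sym_diff:
  fixes A B :: "gen set"
  shows "even (card (sym_diff A B)) \<longleftrightarrow> (even (card A) \<longleftrightarrow> even (card B))"
proof -
  define a b c where "a = card (A - B)" and "b = card (B - A)" and "c = card (A \<inter> B)"
  have "card A = a + c" "card B = b + c" "card (sym_diff A B) = a + b"
    unfolding a_def b_def c_def
    by (subst card_Un_disjoint [symmetric]; auto intro: arg_cong [of _ _ card])+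
  then show ?thesis
    by auto
qed

lemma cga_even_mult: "x \<in> cga_even \<Longrightarrow> y \<in> cga_even \<Longrightarrow> x * y \<in> cga_even"
  unfolding cga_even_def mem_Collect_eq coord_times
proof (intro allI impI sum.neutral ballI)
  fix A C :: "gen set"
  assume "\<forall>A. odd (card A) \<longrightarrow> coord x A = 0" "\<forall>A. odd (card A) \<longrightarrow> coord y A = 0"
    and "odd (card C)"
  moreover from this have "odd (card A) \<or> odd (card (sym_diff A C))"
    by (metis even_card_sym_diff)
  ultimately show "blade_sign A (sym_diff A C) * coord x A * coord y (sym_diff A C) = 0"
    by auto
qed

lemma cga_even_eq_span:
  "cga_even = span {prod_list (map gen as) |as. even (length as)}" (is "_ = span ?S")
proof (rule equalityI; rule subsetI)
  fix x assume x: "x \<in> cga_even"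
  have "coord x A *\<^sub>R blade A \<in> span ?S" for A
  proof (cases "even (card A)")
    case True
    then have "blade A \<in> ?S"
      by (auto simp: blade_eq_prod_list intro!: exI [of _ "sorted_list_of_set A"])
    then show ?thesis
      by (intro span_scale span_base)
  next
    case False
    then show ?thesis
      using x by (simp add: cga_even_def span_zero)
  qed
  then have "(\<Sum>A\<in>UNIV. coord x A *\<^sub>R blade A) \<in> span ?S"
    by (intro span_sum) auto
  then show "x \<in> span ?S"
    by (simp flip: cga_expand)
next
  fix x assume "x \<in> span ?S"
  moreover have "prod_list (map gen as) \<in> cga_even" if "even (length as)" for as
    using that
  proof (induction as rule: induct_list012)
    case 1
    then show ?case by (simp add: cga_even_def)
  next
    case (2 a)
    then show ?case by simp
  next
    case (3 a b as)
    have "gen a * gen b \<in> cga_even"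
      unfolding gen_def blade_times_blade cga_even_def
      using even_card_sym_diff [of "{a}" "{b}"] by auto
    with 3 show ?case
      by (auto simp: cga_even_mult simp flip: mult.assoc)
  qed
  moreover have "subspace cga_even"
    by (auto simp: subspace_def cga_even_def)
  ultimately show "x \<in> cga_even"
    using span_minimal [of ?S cga_even] by blast
qed


section \<open>Polynomials over the even subalgebra\<close>

text \<open>
  \<^typ>\<open>nat \<Rightarrow>\<^sub>0 cga\<close> with the convolution product is the polynomial ring over the noncommutative
  coefficient ring \<^typ>\<open>cga\<close> in a central indeterminate (the product on the type constructor
  \<open>poly\<close> is only available over commutative coefficients).
\<close>

type_synonym cga_poly = "nat \<Rightarrow>\<^sub>0 cga"

lemma indeterminate_central:
  "Poly_Mapping.single (1::nat) (1::cga) * C = C * Poly_Mapping.single 1 1"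
proof (induction C rule: Poly_Mapping.update_induct)
  case const
  then show ?case by simp
next
  case (update C k v)
  have "Poly_Mapping.update k v C = C + Poly_Mapping.single k v"
    using update.hyps
    by (intro poly_mapping_eqI)
      (auto simp: lookup_update lookup_add lookup_single when_def in_keys_iff)
  with update.IH show ?case
    by (simp add: distrib_left distrib_right mult_single)
qed

definition poly_reverse :: "cga_poly \<Rightarrow> cga_poly" where
  "poly_reverse C = Poly_Mapping.map reverse C"

lemma lookup_poly_reverse [simp]:
  "Poly_Mapping.lookup (poly_reverse C) i = reverse (Poly_Mapping.lookup C i)"
  unfolding poly_reverse_def by (simp add: Poly_Mapping.map.rep_eq when_def)

definition even_polys :: "cga_poly set" where
  "even_polys = {C. \<forall>i. Poly_Mapping.lookup C i \<in> cga_even}"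

text \<open>Here \<open>\<real>\<close> is the set of real scalars inside \<^typ>\<open>cga\<close>.\<close>

definition real_polys :: "cga_poly set" where
  "real_polys = {C. \<forall>i. Poly_Mapping.lookup C i \<in> \<real>}"

text \<open>\<^const>\<open>Poly_Mapping.degree\<close> is one more than the usual degree of a nonzero polynomial.\<close>

definition poly_degree :: "cga_poly \<Rightarrow> nat" where
  "poly_degree C = Poly_Mapping.degree C - 1"

definition spinor_poly :: "cga_poly \<Rightarrow> bool" where
  "spinor_poly C \<longleftrightarrow> C \<in> even_polys \<and> C * poly_reverse C = poly_reverse C * C \<and>
     C * poly_reverse C \<in> real_polys - {0}"

definition has_linear_factorization :: "cga_poly \<Rightarrow> bool" where
  "has_linear_factorization C \<longleftrightarrow>
     (\<exists>Ls. (\<forall>L\<in>set Ls. spinor_poly L \<and> poly_degree L = 1) \<and> C = prod_list Ls)"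

end

theory Submission
  imports Defs "HOL-Computational_Algebra.Fundamental_Theorem_Algebra"
begin

text \<open>
  The elements \<open>e\<^sub>2e\<^sub>3\<close>, \<open>e\<^sub>3e\<^sub>1\<close> generate the quaternions \<open>\<bbbH>\<close> and commute with
  \<open>e\<^sub>+e\<^sub>-\<close> and \<open>e\<^sub>1e\<^sub>2e\<^sub>3e\<^sub>+\<close>, which generate the real \<open>2 \<times> 2\<close> matrices. Hence the even subalgebra is the
  algebra of \<open>2 \<times> 2\<close> matrices over \<open>\<bbbH>\<close>, where the reverse maps the matrix with rows \<open>(a, b)\<close>, \<open>(c, d)\<close>
  to the one with rows \<open>(d', b')\<close>, \<open>(c', a')\<close>, the prime denoting quaternion conjugation.

  The polynomials that have a real multiple with a linear factorization are closed under products,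
  and real factors can be cancelled in them. By Bruhat decomposition over the rational functions,
  every spinor polynomial is up to real factors a product of unipotent matrices with an imaginary
  off-diagonal entry, the antidiagonal unit matrix, real diagonal matrices and scalar matrices with
  entry in \<open>\<bbbH>[t]\<close>. The latter are products of two imaginary ones, which come from unipotent and
  diagonal matrices. Unipotent matrices with entry \<open>f i\<close> are conjugates of constant ones by the
  diagonal matrix \<open>(f, 1)\<close>. By the fundamental theorem of algebra it remains to treat that matrix for \<open>f\<close>
  linear, which is clear, and for \<open>f = (t - a)\<^sup>2 + b\<^sup>2\<close>, which is the norm of the linear spinor
  polynomial with rows \<open>(t - a, b i)\<close>, \<open>(b i, t - a)\<close>.
\<close>


section \<open>Polynomials over the Clifford algebra\<close>

lemma cga_poly_expand:
  fixes C :: cga_poly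
  shows "C = (\<Sum>k\<in>Poly_Mapping.keys C. Poly_Mapping.single k (Poly_Mapping.lookup C k))"
  by (rule poly_mapping_eqI)
    (auto simp: lookup_sum lookup_single when_def in_keys_iff sum.delta)

text \<open>Reduces additive statements to monomials.\<close>

lemma cga_poly_induct [case_names single add]:
  fixes C :: cga_poly
  assumes "\<And>k x. Q (Poly_Mapping.single k x)" "\<And>C D. Q C \<Longrightarrow> Q D \<Longrightarrow> Q (C + D)"
  shows "Q C"
proof -
  have "Q (\<Sum>k\<in>A. Poly_Mapping.single k (f k))" if "finite A" for A f
    using that
  proof (induction A rule: finite_induct)
    case empty
    show ?case using assms(1) [of 0 0] by simp
  qed (simp add: assms)
  then show ?thesis
    by (subst cga_poly_expand) simp
qed

lemma poly_reverse_simps [simp]: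
  "poly_reverse 0 = 0" "poly_reverse 1 = 1"
  "poly_reverse (C + D) = poly_reverse C + poly_reverse D"
  "poly_reverse (- C) = - poly_reverse C"
  "poly_reverse (C - D) = poly_reverse C - poly_reverse D"
  "poly_reverse (Poly_Mapping.single k x) = Poly_Mapping.single k (reverse x)"
proof -
  have minus: "reverse (- x) = - reverse x" for x
    using reverse_linear(3) [of "-1" x] by simp
  then have diff: "reverse (x - y) = reverse x - reverse y" for x y
    using reverse_linear(2) [of x "- y"] by simp
  show "poly_reverse 0 = 0" "poly_reverse 1 = 1"
    "poly_reverse (C + D) = poly_reverse C + poly_reverse D"
    "poly_reverse (- C) = - poly_reverse C"
    "poly_reverse (C - D) = poly_reverse C - poly_reverse D"
    "poly_reverse (Poly_Mapping.single k x) = Poly_Mapping.single k (reverse x)"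
    by (rule poly_mapping_eqI;
        simp add: lookup_add lookup_minus lookup_one lookup_single when_def minus diff)+
qed

lemma poly_reverse_mult: "poly_reverse (C * D) = poly_reverse D * poly_reverse C"
proof (induction C rule: cga_poly_induct)
  case (single k x)
  show ?case
    by (induction D rule: cga_poly_induct)
      (simp_all add: mult_single reverse_mult distrib_left distrib_right add.commute)
qed (simp add: distrib_left distrib_right)

lemma single_in_even_polys: "x \<in> cga_even \<Longrightarrow> Poly_Mapping.single k x \<in> even_polys"
  by (auto simp: even_polys_def lookup_single when_def cga_even_def)

lemma even_polys_add: "C \<in> even_polys \<Longrightarrow> D \<in> even_polys \<Longrightarrow> C + D \<in> even_polys"
  by (auto simp: even_polys_def cga_even_def lookup_add)

lemma even_polys_diff: "C \<in> even_polys \<Longrightarrow> D \<in> even_polys \<Longrightarrow> C - D \<in> even_polys"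
  by (auto simp: even_polys_def cga_even_def lookup_minus)

lemma even_polys_sum: "(\<And>i. i \<in> A \<Longrightarrow> f i \<in> even_polys) \<Longrightarrow> sum f A \<in> even_polys"
  by (auto simp: even_polys_def cga_even_def lookup_sum)

lemma even_polys_mult:
  assumes "C \<in> even_polys" "D \<in> even_polys"
  shows "C * D \<in> even_polys"
proof -
  have "Poly_Mapping.single (k + l) (Poly_Mapping.lookup C k * Poly_Mapping.lookup D l) \<in> even_polys" for k l
    using assms by (intro single_in_even_polys cga_even_mult) (auto simp: even_polys_def)
  then show ?thesis
    by (subst (1 2) cga_poly_expand) (simp add: sum_product mult_single even_polys_sum)
qed

section \<open>Real polynomials\<close>

text \<open>An embedding of \<open>real poly\<close>, so that degrees, division with remainder and
  complex roots are available for the real factors.\<close>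

definition rpoly :: "real poly \<Rightarrow> cga_poly" where
  "rpoly p = (\<Sum>i\<le>degree p. Poly_Mapping.single i (of_real (coeff p i)))"

lemma lookup_rpoly [simp]: "Poly_Mapping.lookup (rpoly p) i = of_real (coeff p i)"
  by (auto simp: rpoly_def lookup_sum lookup_single when_def coeff_eq_0)

lemma rpoly_simps [simp]:
  "rpoly 0 = 0" "rpoly 1 = 1" "rpoly (p + q) = rpoly p + rpoly q"
  "rpoly (- p) = - rpoly p" "rpoly (p - q) = rpoly p - rpoly q"
  by (rule poly_mapping_eqI; simp add: lookup_add lookup_minus lookup_one when_def)+

lemma rpoly_monom: "rpoly (monom a k) = Poly_Mapping.single k (of_real a)"
  by (rule poly_mapping_eqI) (simp add: lookup_single when_def)

lemma rpoly_eq_iff [simp]: "rpoly p = rpoly q \<longleftrightarrow> p = q"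
proof
  assume "rpoly p = rpoly q"
  then have "Poly_Mapping.lookup (rpoly p) i = Poly_Mapping.lookup (rpoly q) i" for i
    by simp
  then show "p = q"
    by (simp add: poly_eq_iff)
qed simp

lemma rpoly_eq_0_iff [simp]: "rpoly p = 0 \<longleftrightarrow> p = 0"
  by (metis rpoly_eq_iff rpoly_simps(1))

lemma monom_induct [case_names monom add]:
  fixes p :: "'a :: comm_monoid_add poly"
  assumes "\<And>a k. Q (monom a k)" "\<And>p q. Q p \<Longrightarrow> Q q \<Longrightarrow> Q (p + q)"
  shows "Q p"
proof -
  have "Q (\<Sum>k\<in>A. monom (f k) k)" if "finite A" for A f
    using that
  proof (induction A rule: finite_induct)
    case empty
    show ?case using assms(1) [of 0 0] by simp
  qed (simp add: assms)
  from this [of "{..degree p}" "coeff p"] show ?thesis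
    by (simp add: poly_as_sum_of_monoms)
qed

lemma rpoly_mult [simp]: "rpoly (p * q) = rpoly p * rpoly q"
proof (induction p rule: monom_induct)
  case (monom a k)
  show ?case
    by (induction q rule: monom_induct)
      (simp_all add: rpoly_monom mult_monom mult_single distrib_left)
qed (simp add: distrib_right)

text \<open>Real scalars and the indeterminate are both central.\<close>

lemma rpoly_commute: "C * rpoly p = rpoly p * C"
proof (induction p rule: monom_induct)
  case (monom a k)
  show ?case
    by (induction C rule: cga_poly_induct)
      (simp_all add: rpoly_monom mult_single distrib_left distrib_right add.commute
        Reals_def scaleR_conv_of_real [symmetric] of_real_def)
qed (simp add: distrib_left distrib_right)

lemma real_polys_eq: "real_polys = range rpoly"
proof (rule equalityI; rule subsetI)
  fix C :: cga_poly
  assume "C \<in> real_polys"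
  then have "\<forall>i. \<exists>r. Poly_Mapping.lookup C i = of_real r"
    by (auto simp: real_polys_def Reals_def)
  then obtain r where r: "\<And>i. Poly_Mapping.lookup C i = of_real (r i)"
    by metis
  have "rpoly (\<Sum>i\<in>A. monom (r i) i) = (\<Sum>i\<in>A. Poly_Mapping.single i (Poly_Mapping.lookup C i))"
    if "finite A" for A
    using that by (induction A rule: finite_induct) (simp_all add: rpoly_monom r)
  from this [of "Poly_Mapping.keys C"] show "C \<in> range rpoly"
    by (metis cga_poly_expand finite_keys rangeI)
qed (auto simp: real_polys_def)

lemma poly_reverse_rpoly [simp]: "poly_reverse (rpoly p) = rpoly p"
  by (rule poly_mapping_eqI) (simp add: of_real_def)

lemma rpoly_even: "rpoly p \<in> even_polys"
  by (auto simp: even_polys_def cga_even_def of_real_def)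

lemma rpoly_left_commute: "C * (rpoly q * D) = rpoly q * (C * D)"
  by (simp only: rpoly_commute [of C q] flip: mult.assoc)

lemma rpoly_times [simp]: "rpoly p * C * (rpoly q * D) = rpoly p * rpoly q * (C * D)"
  by (simp only: rpoly_left_commute [of C q D] mult.assoc)

section \<open>Quaternions\<close>

definition pgen :: "gen \<Rightarrow> cga_poly" where
  "pgen a = Poly_Mapping.single 0 (gen a)"

lemma pgen_square:
  "pgen G1 * pgen G1 = 1" "pgen G2 * pgen G2 = 1" "pgen G3 * pgen G3 = 1"
  "pgen Gplus * pgen Gplus = 1" "pgen Gminus * pgen Gminus = -1"
  by (simp_all only: pgen_def mult_single gen_mult_self gen_square_def single_uminus
    gen.simps simp_thms if_True if_False scaleR_one scaleR_minus1_left add_0 single_one)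

lemma pgen_anticommute: "a \<noteq> b \<Longrightarrow> pgen a * pgen b = - (pgen b * pgen a)"
  unfolding pgen_def mult_single by (subst gen_anticommute) (simp_all only: single_uminus not_False_eq_True)

lemma pgen_swap:
  "pgen G2 * pgen G1 = - (pgen G1 * pgen G2)"
  "pgen G3 * pgen G1 = - (pgen G1 * pgen G3)"
  "pgen G3 * pgen G2 = - (pgen G2 * pgen G3)"
  "pgen Gplus * pgen G1 = - (pgen G1 * pgen Gplus)"
  "pgen Gplus * pgen G2 = - (pgen G2 * pgen Gplus)"
  "pgen Gplus * pgen G3 = - (pgen G3 * pgen Gplus)"
  "pgen Gminus * pgen G1 = - (pgen G1 * pgen Gminus)"
  "pgen Gminus * pgen G2 = - (pgen G2 * pgen Gminus)"
  "pgen Gminus * pgen G3 = - (pgen G3 * pgen Gminus)"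
  "pgen Gminus * pgen Gplus = - (pgen Gplus * pgen Gminus)"
  by (rule pgen_anticommute, simp)+

text \<open>Lets a rule for two adjacent factors act inside a right-nested product.\<close>

lemma mult_eq_left: "a * b = c \<Longrightarrow> a * (b * x) = c * x" for a b c x :: "'a :: semigroup_mult"
  by (simp flip: mult.assoc)

text \<open>Rewriting with these rules sorts a word and removes squares, which proves identities
  between words in the generators.\<close>

lemmas pgen_normal = pgen_square pgen_swap pgen_square [THEN mult_eq_left]
  pgen_swap [THEN mult_eq_left] mult.assoc

lemma poly_reverse_pgen [simp]: "poly_reverse (pgen a) = pgen a"
  by (simp add: pgen_def)

lemma pgen_mult_even: "pgen a * pgen b \<in> even_polys"
proof -
  have "prod_list (map gen [a, b]) \<in> cga_even"
    unfolding cga_even_eq_span by (intro span_base CollectI exI [of _ "[a, b]"] conjI) auto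
  then show ?thesis by (simp add: pgen_def mult_single single_in_even_polys)
qed

definition qI :: cga_poly where "qI = pgen G2 * pgen G3"
definition qJ :: cga_poly where "qJ = pgen G3 * pgen G1"
text \<open>The factors stand in the order that \<open>qI * qJ\<close> = e_2 e_3 e_3 e_1 leaves, so
  that no sign enters.\<close>

definition qK :: cga_poly where "qK = pgen G2 * pgen G1"
text \<open>\<open>hyp\<close> and \<open>swap\<close> have square 1 and anticommute, like the
  matrices with rows (1, 0), (0, -1) and (0, 1), (1, 0).\<close>

definition hyp :: cga_poly where "hyp = pgen Gplus * pgen Gminus"
definition swap :: cga_poly where "swap = pgen G1 * pgen G2 * (pgen G3 * pgen Gplus)"

lemmas unit_defs = qI_def qJ_def qK_def hyp_def swap_def

lemma quaternion_units [simp]: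
  "qI * qI = -1" "qJ * qJ = -1" "qK * qK = -1"
  "qI * qJ = qK" "qJ * qK = qI" "qK * qI = qJ"
  "qJ * qI = -qK" "qK * qJ = -qI" "qI * qK = -qJ"
  by (simp_all add: unit_defs pgen_normal)

lemma hyp_swap [simp]: "hyp * hyp = 1" "swap * swap = 1" "swap * hyp = - (hyp * swap)"
  by (simp_all add: unit_defs pgen_normal)

lemma hyp_swap_commute [simp]:
  "hyp * qI = qI * hyp" "hyp * qJ = qJ * hyp" "hyp * qK = qK * hyp"
  "swap * qI = qI * swap" "swap * qJ = qJ * swap" "swap * qK = qK * swap"
  by (simp_all add: unit_defs pgen_normal)

lemma poly_reverse_units [simp]:
  "poly_reverse qI = -qI" "poly_reverse qJ = -qJ" "poly_reverse qK = -qK"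
  "poly_reverse hyp = -hyp" "poly_reverse swap = swap"
  by (simp_all add: unit_defs pgen_normal poly_reverse_mult)

lemma units_even: "qI \<in> even_polys" "qJ \<in> even_polys" "qK \<in> even_polys" "hyp \<in> even_polys" "swap \<in> even_polys"
  by (auto simp: unit_defs intro!: pgen_mult_even even_polys_mult)

section \<open>Polynomials with quaternion coefficients\<close>

definition quat :: "real poly \<Rightarrow> real poly \<Rightarrow> real poly \<Rightarrow> real poly \<Rightarrow> cga_poly" where
  "quat a b c d = rpoly a + rpoly b * qI + rpoly c * qJ + rpoly d * qK"

lemma rpoly_times_right: "rpoly p * C * rpoly q = rpoly p * rpoly q * C" 
  by (simp only: rpoly_commute [of C q] mult.assoc)

lemma quat_mult: "quat a b c d * quat a' b' c' d' =
  quat (a*a' - b*b' - c*c' - d*d') (a*b' + b*a' + c*d' - d*c')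
       (a*c' - b*d' + c*a' + d*b') (a*d' + b*c' - c*b' + d*a')"
  unfolding quat_def
  by (simp add: rpoly_times_right distrib_left distrib_right left_diff_distrib mult.assoc [symmetric, of "rpoly _" "rpoly _"])

lemma quat_add: "quat a b c d + quat a' b' c' d' = quat (a+a') (b+b') (c+c') (d+d')"
  by (simp add: quat_def distrib_right)

lemma quat_reverse: "poly_reverse (quat a b c d) = quat a (-b) (-c) (-d)"
  by (simp add: quat_def poly_reverse_mult rpoly_commute)


definition quats :: "cga_poly set" where "quats = {quat a b c d |a b c d. True}"

lemma quat_in_quats [simp]: "quat a b c d \<in> quats"
  by (auto simp: quats_def)

lemma quatsE:
  assumes "x \<in> quats" obtains a b c d where "x = quat a b c d"
  using assms by (auto simp: quats_def)

lemma quats_mult [simp]: "x \<in> quats \<Longrightarrow> y \<in> quats \<Longrightarrow> x * y \<in> quats"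
  by (elim quatsE) (simp add: quat_mult)

lemma quats_add [simp]: "x \<in> quats \<Longrightarrow> y \<in> quats \<Longrightarrow> x + y \<in> quats"
  by (elim quatsE) (simp add: quat_add)

lemma quats_poly_reverse [simp]: "x \<in> quats \<Longrightarrow> poly_reverse x \<in> quats"
  by (elim quatsE) (simp add: quat_reverse)

lemma rpoly_eq_quat: "rpoly p = quat p 0 0 0"
  by (simp add: quat_def)

lemma rpoly_in_quats [simp]: "rpoly p \<in> quats"
  by (simp add: rpoly_eq_quat)

lemma zero_in_quats [simp]: "0 \<in> quats" and one_in_quats [simp]: "1 \<in> quats"
  using rpoly_in_quats [of 0] rpoly_in_quats [of 1] by simp_all

lemma quats_uminus [simp]: "x \<in> quats \<Longrightarrow> - x \<in> quats"
  using quats_mult [OF rpoly_in_quats [of "-1"], of x] by (simp del: rpoly_in_quats quats_mult)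

lemma quats_diff [simp]: "x \<in> quats \<Longrightarrow> y \<in> quats \<Longrightarrow> x - y \<in> quats"
  using quats_add [of x "- y"] by simp

lemma units_in_quats [simp]: "qI \<in> quats" "qJ \<in> quats" "qK \<in> quats"
proof -
  have "qI = quat 0 1 0 0" "qJ = quat 0 0 1 0" "qK = quat 0 0 0 1"
    by (simp_all add: quat_def)
  then show "qI \<in> quats" "qJ \<in> quats" "qK \<in> quats"
    by (metis quat_in_quats)+
qed

lemma quats_even: "x \<in> quats \<Longrightarrow> x \<in> even_polys"
  by (elim quatsE) (auto simp: quat_def intro!: even_polys_add even_polys_mult rpoly_even units_even)

text \<open>Evaluation at any real point gives a vanishing sum of squares of reals. This makes the
  quaternion norm definite.\<close>

lemma sum_squares_poly_eq_0:
  fixes a b :: "real poly"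
  assumes "a\<^sup>2 + b\<^sup>2 + c\<^sup>2 + d\<^sup>2 = 0"
  shows "a = 0 \<and> b = 0 \<and> c = 0 \<and> d = 0"
proof -
  have "poly a x = 0 \<and> poly b x = 0 \<and> poly c x = 0 \<and> poly d x = 0" for x
  proof -
    have "(poly a x)\<^sup>2 + (poly b x)\<^sup>2 + (poly c x)\<^sup>2 + (poly d x)\<^sup>2 = 0"
      using arg_cong [OF assms, of "\<lambda>p. poly p x"] by (simp add: poly_power)
    then show ?thesis
      by (simp add: add_nonneg_eq_0_iff)
  qed
  then show ?thesis
    using poly_all_0_iff_0 by blast
qed

text \<open>On \<open>quats\<close> the reverse is quaternion conjugation, so both products are the
  sum of the squares of the four components.\<close>

lemma quats_norm:
  assumes "x \<in> quats"
  obtains n where "x * poly_reverse x = rpoly n" "poly_reverse x * x = rpoly n" "x \<noteq> 0 \<longrightarrow> n \<noteq> 0"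
proof -
  from assms obtain a b c d where x: "x = quat a b c d" by (rule quatsE)
  show thesis
  proof
    let ?n = "a\<^sup>2 + b\<^sup>2 + c\<^sup>2 + d\<^sup>2"
    show "x * poly_reverse x = rpoly ?n" "poly_reverse x * x = rpoly ?n"
      unfolding rpoly_eq_quat
      by (simp_all add: x quat_reverse quat_mult power2_eq_square algebra_simps del: rpoly_simps rpoly_mult)
    show "x \<noteq> 0 \<longrightarrow> ?n \<noteq> 0"
      using sum_squares_poly_eq_0 [of a b c d] by (auto simp: x quat_def)
  qed
qed

text \<open>\<open>x + poly_reverse x\<close> is twice the real part of \<open>x\<close>.\<close>

lemma quats_imaginary:
  assumes "x \<in> quats" "poly_reverse x = - x"
  obtains b c d where "x = quat 0 b c d"
proof -
  from assms(1) obtain a b c d where x: "x = quat a b c d" by (rule quatsE)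
  have "rpoly (a + a) = x + poly_reverse x"
    by (simp add: x quat_reverse quat_add rpoly_eq_quat del: rpoly_simps rpoly_mult)
  also have "\<dots> = 0" using assms by simp
  finally have "a + a = 0" unfolding rpoly_eq_0_iff .
  then have "a = 0" by simp
  then show thesis using that x by simp
qed

section \<open>Matrices over the quaternions\<close>

text \<open>Since \<open>hyp\<close> squares to 1, these are complementary idempotents: the two
  diagonal matrix units.\<close>

definition idem_p where "idem_p = rpoly [:1/2:] * (1 + hyp)"
definition idem_m where "idem_m = rpoly [:1/2:] * (1 - hyp)"

lemma add_diff_eq_cancel: "(a + b) + (c - b) = a + c" for a b c :: "'a :: ab_group_add"
  by simp

lemma idem_sum: "idem_p + idem_m = 1"
proof -
  have "idem_p + idem_m = rpoly [:1/2:] + rpoly [:1/2:]"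
    by (simp only: idem_p_def idem_m_def distrib_left right_diff_distrib mult_1_right) (rule add_diff_eq_cancel)
  also have "\<dots> = rpoly ([:1/2:] + [:1/2:])"
    by (simp only: rpoly_simps)
  also have "[:1/2:] + [:1/2:] = (1 :: real poly)"
    by simp
  finally show ?thesis by simp
qed

text \<open>Orthogonality is 1 - \<open>hyp * hyp\<close> = 0. Idempotency then follows on
  multiplying \<open>idem_p + idem_m = 1\<close> by either summand.\<close>

lemma idem_products [simp]: "idem_p * idem_p = idem_p" "idem_p * idem_m = 0" "idem_m * idem_p = 0" "idem_m * idem_m = idem_m"
proof -
  have uv: "idem_p * idem_m = 0" "idem_m * idem_p = 0"
    using rpoly_times [of "[:1/2:]" "1 + hyp" "[:1/2:]" "1 - hyp"] rpoly_times [of "[:1/2:]" "1 - hyp" "[:1/2:]" "1 + hyp"]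
    by (simp_all add: idem_p_def idem_m_def distrib_right left_diff_distrib)
       (simp_all add: distrib_left right_diff_distrib)
  have "idem_p * (idem_p + idem_m) = idem_p" "idem_m * (idem_p + idem_m) = idem_m"
    by (simp_all add: idem_sum)
  with uv show "idem_p * idem_p = idem_p" "idem_p * idem_m = 0" "idem_m * idem_p = 0" "idem_m * idem_m = idem_m"
    by (simp_all add: distrib_left)
qed

lemma commute_mult: "x * a = a * x \<Longrightarrow> x * b = b * x \<Longrightarrow> x * (a * b) = a * b * x"
  for x a b :: "'a :: semigroup_mult"
  by (metis mult.assoc)

lemma commute_add: "x * a = a * x \<Longrightarrow> x * b = b * x \<Longrightarrow> x * (a + b) = (a + b) * x"
  for x a b :: "'a :: semiring"
  by (simp add: distrib_left distrib_right)

lemma commute_diff: "x * a = a * x \<Longrightarrow> x * b = b * x \<Longrightarrow> x * (a - b) = (a - b) * x"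
  for x a b :: "'a :: ring"
  by (simp add: right_diff_distrib left_diff_distrib)

text \<open>\<open>swap\<close> anticommutes with \<open>hyp\<close>, so moving it past an
  idempotent changes the sign inside.\<close>

lemma swap_idem_p: "swap * idem_p = idem_m * swap" and swap_idem_m: "swap * idem_m = idem_p * swap"
proof -
  have "swap * (rpoly p * x) = rpoly p * (swap * x)" for p x
    by (rule rpoly_left_commute)
  with rpoly_commute [of swap] show "swap * idem_p = idem_m * swap" "swap * idem_m = idem_p * swap"
    by (simp_all add: idem_p_def idem_m_def mult.assoc distrib_left distrib_right left_diff_distrib right_diff_distrib)
qed

lemma quats_hyp_swap: "x \<in> quats \<Longrightarrow> hyp * x = x * hyp" "x \<in> quats \<Longrightarrow> swap * x = x * swap"
  by (elim quatsE; simp only: quat_def; intro commute_add commute_mult rpoly_commute hyp_swap_commute)+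

lemma quats_idem: "x \<in> quats \<Longrightarrow> idem_p * x = x * idem_p" "x \<in> quats \<Longrightarrow> idem_m * x = x * idem_m"
  unfolding idem_p_def idem_m_def
  by (rule sym, intro commute_add commute_diff commute_mult rpoly_commute; simp add: quats_hyp_swap)+

text \<open>\<open>idem_p * swap\<close> and \<open>idem_m * swap\<close> are the upper right and
  lower left matrix units.\<close>

definition mat where "mat a b c d = a * idem_p + b * (idem_p * swap) + c * (idem_m * swap) + d * idem_m"

text \<open>Quaternion entries commute with the matrix units, so everything reduces to the
  multiplication table of the units.\<close>

lemma mat_mult:
  assumes "a' \<in> quats" "b' \<in> quats" "c' \<in> quats" "d' \<in> quats"
  shows "mat a b c d * mat a' b' c' d' =
    mat (a * a' + b * c') (a * b' + b * d') (c * a' + d * c') (c * b' + d * d')"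
proof -
  have e: "idem_p * x = x * idem_p" "idem_m * x = x * idem_m" "idem_p * swap * x = x * (idem_p * swap)" "idem_m * swap * x = x * (idem_m * swap)" if "x \<in> quats" for x
    using quats_idem [OF that] quats_hyp_swap [OF that] by (metis mult.assoc)+
  have comm: "x * idem_p * (y * f) = x * y * (idem_p * f)" "x * idem_m * (y * f) = x * y * (idem_m * f)"
    "x * (idem_p * swap) * (y * f) = x * y * (idem_p * swap * f)" "x * (idem_m * swap) * (y * f) = x * y * (idem_m * swap * f)"
    if "y \<in> quats" for x y f
    using e [OF that] by (metis mult.assoc)+
  have swap': "swap * (idem_p * x) = idem_m * (swap * x)" "swap * (idem_m * x) = idem_p * (swap * x)" for x
    by (metis swap_idem_p mult.assoc, metis swap_idem_m mult.assoc)
  have m: "idem_p * (idem_p * swap) = idem_p * swap" "idem_p * (idem_m * swap) = 0" "idem_m * (idem_p * swap) = 0" "idem_m * (idem_m * swap) = idem_m * swap"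
    "idem_p * swap * idem_p = 0" "idem_p * swap * idem_m = idem_p * swap" "idem_m * swap * idem_p = idem_m * swap" "idem_m * swap * idem_m = 0"
    "idem_p * swap * (idem_p * swap) = 0" "idem_p * swap * (idem_m * swap) = idem_p" "idem_m * swap * (idem_p * swap) = idem_m" "idem_m * swap * (idem_m * swap) = 0"
    by (simp_all add: mult.assoc swap_idem_p swap_idem_m swap')
      (simp_all add: mult.assoc [symmetric, of _ _ swap])
  show ?thesis
    unfolding mat_def by (simp add: distrib_left distrib_right comm m assms)
qed

lemma mat_eq_0:
  assumes "mat a b c d = 0" "a \<in> quats" "b \<in> quats" "c \<in> quats" "d \<in> quats"
  shows "a = 0" "b = 0" "c = 0" "d = 0"
proof -
  have *: "a = 0 \<and> b = 0 \<and> c = 0 \<and> d = 0"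
    if mat: "mat a b c d = 0" and q: "a \<in> quats" "b \<in> quats" "c \<in> quats" "d \<in> quats" for a b c d
  proof -
    \<comment> \<open>Conjugation by \<open>swap\<close> turns \<open>x * idem_p\<close> into
      \<open>x * idem_m\<close>, and the two add up to \<open>x\<close>.\<close>
    have zero: "x = 0" if "x * idem_p = 0" "x \<in> quats" for x
    proof -
      have "x * idem_m = x * idem_m * (swap * swap)"
        by simp
      also have "\<dots> = (x * swap) * idem_p * swap"
        by (simp only: mult.assoc swap_idem_p swap_idem_m flip: mult.assoc [of swap idem_p swap])
      also have "\<dots> = swap * (x * idem_p) * swap"
        by (simp only: quats_hyp_swap(2) [OF that(2), symmetric] mult.assoc)
      finally have "x * (idem_p + idem_m) = 0"
        using that by (simp add: distrib_left)
      then show ?thesis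
        by (simp add: idem_sum)
    qed
    \<comment> \<open>Multiplication by matrix units on both sides brings each of the four entries
      alone into the upper left corner.\<close>
    have "mat 1 0 0 0 * mat a b c d * mat 1 0 0 0 = 0" "mat 1 0 0 0 * mat a b c d * mat 0 0 1 0 = 0"
      "mat 0 1 0 0 * mat a b c d * mat 1 0 0 0 = 0" "mat 0 1 0 0 * mat a b c d * mat 0 0 1 0 = 0"
      using mat by simp_all
    then show ?thesis
      using q by (simp add: mat_mult) (simp add: mat_def zero)
  qed
  show "a = 0" "b = 0" "c = 0" "d = 0"
    using * [OF assms] by auto
qed

lemma mat_eq_iff:
  assumes "a \<in> quats" "b \<in> quats" "c \<in> quats" "d \<in> quats"
    "a' \<in> quats" "b' \<in> quats" "c' \<in> quats" "d' \<in> quats"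
  shows "mat a b c d = mat a' b' c' d' \<longleftrightarrow> a = a' \<and> b = b' \<and> c = c' \<and> d = d'"
proof
  assume "mat a b c d = mat a' b' c' d'"
  moreover have "mat (a - a') (b - b') (c - c') (d - d') = mat a b c d - mat a' b' c' d'"
    by (simp only: mat_def left_diff_distrib add_diff_add)
  ultimately have "mat (a - a') (b - b') (c - c') (d - d') = 0"
    by simp
  from mat_eq_0 [OF this] show "a = a' \<and> b = b' \<and> c = c' \<and> d = d'"
    using assms by simp
qed simp

lemma poly_reverse_idem: "poly_reverse idem_p = idem_m" "poly_reverse idem_m = idem_p"
  by (simp_all add: idem_p_def idem_m_def poly_reverse_mult rpoly_commute)

text \<open>Reversal negates \<open>hyp\<close>, hence exchanges the idempotents and with them the
  diagonal positions. It fixes the off-diagonal units.\<close>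

lemma mat_reverse:
  assumes "a \<in> quats" "b \<in> quats" "c \<in> quats" "d \<in> quats"
  shows "poly_reverse (mat a b c d) =
    mat (poly_reverse d) (poly_reverse b) (poly_reverse c) (poly_reverse a)"
proof -
  have e: "idem_p * swap * x = x * (idem_p * swap)" "idem_m * swap * x = x * (idem_m * swap)" if "x \<in> quats" for x
    using quats_idem [OF that] quats_hyp_swap [OF that] by (metis mult.assoc)+
  show ?thesis
    using assms by (simp add: mat_def poly_reverse_mult poly_reverse_idem swap_idem_p swap_idem_m quats_idem e)
qed

lemma mat_even:
  assumes "a \<in> quats" "b \<in> quats" "c \<in> quats" "d \<in> quats"
  shows "mat a b c d \<in> even_polys"
  using assms rpoly_even [of 1] unfolding mat_def idem_p_def idem_m_def
  by (intro even_polys_add even_polys_mult even_polys_diff rpoly_even units_even; simp add: quats_even)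

lemma rpoly_eq_mat: "rpoly p = mat (rpoly p) 0 0 (rpoly p)"
  by (simp add: mat_def idem_sum flip: distrib_left)

lemma quat_eq_mat: "x \<in> quats \<Longrightarrow> x = mat x 0 0 x"
  by (simp add: mat_def idem_sum flip: distrib_left)

lemma swap_eq_mat: "swap = mat 0 1 1 0"
  by (simp add: mat_def idem_sum flip: distrib_right)

lemma hyp_eq_mat: "hyp = mat 1 0 0 (-1)"
proof -
  have "[:1/2:] + [:1/2:] = (1 :: real poly)"
    by simp
  then have "hyp = rpoly ([:1/2:] + [:1/2:]) * hyp"
    by (simp only: rpoly_simps(2) mult_1_left)
  also have "\<dots> = mat 1 0 0 (-1)"
    by (simp only: rpoly_simps) (simp add: mat_def idem_p_def idem_m_def distrib_left distrib_right right_diff_distrib)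
  finally show ?thesis .
qed

text \<open>The matrices form a ring that contains the real polynomials. The even subalgebra is
  spanned by words of even length, so products of two generators suffice.\<close>

lemma even_poly_eq_mat:
  assumes "P \<in> even_polys"
  obtains a b c d where "a \<in> quats" "b \<in> quats" "c \<in> quats" "d \<in> quats" "P = mat a b c d"
proof -
  define X where "X = {mat a b c d |a b c d. a \<in> quats \<and> b \<in> quats \<and> c \<in> quats \<and> d \<in> quats}"
  have XI: "mat a b c d \<in> X" if "a \<in> quats" "b \<in> quats" "c \<in> quats" "d \<in> quats" for a b c d
    using that by (auto simp: X_def)
  have mult: "x * y \<in> X" if "x \<in> X" "y \<in> X" for x y
  proof -
    from that obtain a b c d a' b' c' d' where "x = mat a b c d" "y = mat a' b' c' d'"
      and "a \<in> quats" "b \<in> quats" "c \<in> quats" "d \<in> quats" "a' \<in> quats" "b' \<in> quats" "c' \<in> quats" "d' \<in> quats"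
      unfolding X_def by blast
    then show ?thesis by (simp add: mat_mult XI)
  qed
  have add: "x + y \<in> X" if "x \<in> X" "y \<in> X" for x y
  proof -
    from that obtain a b c d a' b' c' d' where xy: "x = mat a b c d" "y = mat a' b' c' d'"
      and q: "a \<in> quats" "b \<in> quats" "c \<in> quats" "d \<in> quats" "a' \<in> quats" "b' \<in> quats" "c' \<in> quats" "d' \<in> quats"
      unfolding X_def by blast
    have "x + y = mat (a + a') (b + b') (c + c') (d + d')"
      by (simp add: xy mat_def distrib_right)
    with q show ?thesis by (simp add: XI)
  qed
  have quat: "x \<in> X" if "x \<in> quats" for x
    using XI [of x 0 0 x] that by (simp flip: quat_eq_mat)
  have swap: "swap \<in> X" and hyp: "hyp \<in> X"
    unfolding swap_eq_mat hyp_eq_mat by (rule XI; simp)+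
  \<comment> \<open>As \<open>Gplus\<close> squares to 1, it can be inserted twice between any two
    generators, so only pairs with \<open>Gplus\<close> need explicit matrices.\<close>
  have gens: "pgen a * pgen Gplus \<in> X" for a
  proof (cases a)
    case G1
    have "pgen G1 * pgen Gplus = - qI * swap" by (simp add: unit_defs pgen_normal)
    then show ?thesis using G1 mult [OF quat [of "- qI"] swap] by simp
  next
    case G2
    have "pgen G2 * pgen Gplus = - qJ * swap" by (simp add: unit_defs pgen_normal)
    then show ?thesis using G2 mult [OF quat [of "- qJ"] swap] by simp
  next
    case G3
    have "pgen G3 * pgen Gplus = qK * swap" by (simp add: unit_defs pgen_normal)
    then show ?thesis using G3 mult [OF quat [of "qK"] swap] by simp
  next
    case Gplus
    then show ?thesis using quat [of 1] by (simp add: pgen_normal)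
  next
    case Gminus
    have "pgen Gminus * pgen Gplus = (- 1) * hyp" by (simp add: unit_defs pgen_normal)
    then show ?thesis using Gminus mult [OF quat [of "- 1"] hyp] by simp
  qed
  have gens': "pgen Gplus * pgen a \<in> X" for a
  proof (cases "a = Gplus")
    case False
    then have "pgen Gplus * pgen a = (- 1) * (pgen a * pgen Gplus)"
      using pgen_anticommute [of Gplus a] by simp
    then show ?thesis using mult [OF quat [of "- 1"] gens [of a]] by simp
  qed (simp add: gens)
  have pairs: "pgen a * pgen b \<in> X" for a b
  proof -
    have "pgen a * pgen b = (pgen a * pgen Gplus) * (pgen Gplus * pgen b)"
      by (simp add: pgen_normal)
    then show ?thesis using gens gens' mult by metis
  qed
  have words: "Poly_Mapping.single 0 (prod_list (map gen as)) \<in> X" if "even (length as)" for as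
    using that
  proof (induction as rule: induct_list012)
    case 1
    then show ?case using quat [of 1] by simp
  next
    case (3 a b as)
    then have "pgen a * pgen b * Poly_Mapping.single 0 (prod_list (map gen as)) \<in> X"
      using pairs mult by simp
    then show ?case by (simp add: pgen_def mult_single mult.assoc)
  qed simp
  have const_polys: "Poly_Mapping.single 0 x \<in> X" if "x \<in> cga_even" for x
    using that unfolding cga_even_eq_span
  proof (induction rule: span_induct_alt)
    case base
    then show ?case using quat [of 0] by simp
  next
    case (step c x y)
    then obtain as where x: "x = prod_list (map gen as)" and "even (length as)" by blast
    then have "rpoly (monom c 0) * Poly_Mapping.single 0 x \<in> X"
      using words mult quat rpoly_in_quats by metis
    with step.IH add show ?case
      by (simp add: single_add rpoly_monom mult_single of_real_def)
  qed
  have single: "Poly_Mapping.single k x \<in> X" if "x \<in> cga_even" for k x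
    using mult [OF quat [OF rpoly_in_quats [of "monom 1 k"]] const_polys [OF that]]
    by (simp add: rpoly_monom mult_single)
  have "(\<Sum>k\<in>A. Poly_Mapping.single k (Poly_Mapping.lookup P k)) \<in> X" if "finite A" for A
    using that
  proof (induction A rule: finite_induct)
    case empty
    then show ?case using quat [of 0] by simp
  next
    case (insert k A)
    then show ?case using assms add single by (simp add: even_polys_def)
  qed
  then have "P \<in> X"
    by (subst cga_poly_expand) simp
  with that show thesis
    unfolding X_def by blast
qed


section \<open>Spinor polynomials and their norms\<close>

lemma spinor_polyI:
  assumes "C \<in> even_polys" "C * poly_reverse C = rpoly r" "poly_reverse C * C = rpoly r" "r \<noteq> 0"
  shows "spinor_poly C"
  using assms by (auto simp: spinor_poly_def real_polys_eq)

lemma spinor_polyE: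
  assumes "spinor_poly C"
  obtains r where "C \<in> even_polys" "C * poly_reverse C = rpoly r" "poly_reverse C * C = rpoly r" "r \<noteq> 0"
proof -
  from assms obtain r where r: "C * poly_reverse C = rpoly r"
    and C: "C \<in> even_polys" "C * poly_reverse C = poly_reverse C * C" "C * poly_reverse C \<noteq> 0"
    unfolding spinor_poly_def real_polys_eq by blast
  moreover from this have "poly_reverse C * C = rpoly r" "r \<noteq> 0"
    by auto
  ultimately show thesis
    using that by blast
qed

text \<open>The norm is multiplicative, because the inner norm is real and hence central.\<close>

lemma spinor_poly_mult:
  assumes "spinor_poly C" "spinor_poly D"
  shows "spinor_poly (C * D)"
proof -
  obtain r where C: "C \<in> even_polys" "C * poly_reverse C = rpoly r" "poly_reverse C * C = rpoly r" "r \<noteq> 0"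
    using assms(1) by (rule spinor_polyE)
  obtain s where D: "D \<in> even_polys" "D * poly_reverse D = rpoly s" "poly_reverse D * D = rpoly s" "s \<noteq> 0"
    using assms(2) by (rule spinor_polyE)
  have "C * D * poly_reverse (C * D) = C * (D * poly_reverse D) * poly_reverse C"
    "poly_reverse (C * D) * (C * D) = poly_reverse D * (poly_reverse C * C) * D"
    by (simp_all only: poly_reverse_mult mult.assoc)
  then have "C * D * poly_reverse (C * D) = rpoly (r * s)" "poly_reverse (C * D) * (C * D) = rpoly (r * s)"
    using C D rpoly_commute [of C s] rpoly_commute [of "poly_reverse D" r] rpoly_commute [of "rpoly r" s]
    by (simp_all add: mult.assoc)
  with C D show ?thesis
    by (intro spinor_polyI [of _ "r * s"]) (auto intro: even_polys_mult)
qed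

section \<open>Polynomials with a factorable real multiple\<close>

text \<open>The free real factor replaces denominators: a matrix over the rational functions is
  represented by a real polynomial multiple of it.\<close>

definition factorable :: "cga_poly set" where
  "factorable = {C. \<exists>f. f \<noteq> 0 \<and> has_linear_factorization (C * rpoly f)}"

lemma has_linear_factorization_mult:
  assumes "has_linear_factorization C" "has_linear_factorization D"
  shows "has_linear_factorization (C * D)"
proof -
  from assms obtain Ls Ms where C: "C = prod_list Ls" "\<forall>L\<in>set Ls. spinor_poly L \<and> poly_degree L = 1"
    and D: "D = prod_list Ms" "\<forall>L\<in>set Ms. spinor_poly L \<and> poly_degree L = 1"
    unfolding has_linear_factorization_def by blast
  show ?thesis
    unfolding has_linear_factorization_def
    by (rule exI [of _ "Ls @ Ms"]) (use C D in auto)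
qed

lemma factorableI: "has_linear_factorization (C * rpoly f) \<Longrightarrow> f \<noteq> 0 \<Longrightarrow> C \<in> factorable"
  by (auto simp: factorable_def)

lemma factorable_mult:
  assumes "C \<in> factorable" "D \<in> factorable"
  shows "C * D \<in> factorable"
proof -
  from assms obtain f g where "f \<noteq> 0" "g \<noteq> 0" and
    fac: "has_linear_factorization (C * rpoly f)" "has_linear_factorization (D * rpoly g)"
    by (auto simp: factorable_def)
  have "C * D * rpoly (f * g) = (C * rpoly f) * (D * rpoly g)"
    by (simp only: rpoly_mult mult.assoc rpoly_left_commute [of D f "rpoly g"])
  with \<open>f \<noteq> 0\<close> \<open>g \<noteq> 0\<close> has_linear_factorization_mult [OF fac] show ?thesis
    by (intro factorableI [of _ "f * g"]) simp_all
qed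

lemma factorable_cancel:
  assumes "rpoly f * C \<in> factorable" "f \<noteq> 0"
  shows "C \<in> factorable"
proof -
  from assms(1) obtain g where "g \<noteq> 0" "has_linear_factorization (rpoly f * C * rpoly g)"
    by (auto simp: factorable_def)
  moreover have "rpoly f * C * rpoly g = C * rpoly (f * g)"
    by (simp only: rpoly_commute [of C f, symmetric] mult.assoc rpoly_mult)
  ultimately show ?thesis
    using assms(2) by (intro factorableI [of _ "f * g"]) simp_all
qed

section \<open>Polynomials of degree at most one\<close>

definition affine_polys :: "cga_poly set" where
  "affine_polys = {Poly_Mapping.single 0 x + Poly_Mapping.single 1 y |x y. True}"

definition const_polys :: "cga_poly set" where
  "const_polys = range (Poly_Mapping.single 0)"

lemma affineI: "Poly_Mapping.single 0 x + Poly_Mapping.single 1 y \<in> affine_polys"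
  by (auto simp: affine_polys_def)

lemma affine_add: "C \<in> affine_polys \<Longrightarrow> D \<in> affine_polys \<Longrightarrow> C + D \<in> affine_polys"
proof -
  assume "C \<in> affine_polys" "D \<in> affine_polys"
  then obtain x y x' y' where "C = Poly_Mapping.single 0 x + Poly_Mapping.single 1 y"
    "D = Poly_Mapping.single 0 x' + Poly_Mapping.single 1 y'"
    by (auto simp: affine_polys_def)
  then have "C + D = Poly_Mapping.single 0 (x + x') + Poly_Mapping.single 1 (y + y')"
    by (simp add: single_add)
  then show ?thesis by (simp only: affineI)
qed

lemma affine_mult: "C \<in> affine_polys \<Longrightarrow> D \<in> const_polys \<Longrightarrow> C * D \<in> affine_polys"
proof -
  assume "C \<in> affine_polys" "D \<in> const_polys"
  then obtain x y z where "C = Poly_Mapping.single 0 x + Poly_Mapping.single 1 y" "D = Poly_Mapping.single 0 z"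
    by (auto simp: affine_polys_def const_polys_def)
  then have "C * D = Poly_Mapping.single 0 (x * z) + Poly_Mapping.single 1 (y * z)"
    by (simp add: distrib_right mult_single)
  then show ?thesis by (simp only: affineI)
qed

lemma const_affine: "C \<in> const_polys \<Longrightarrow> C \<in> affine_polys"
  using affineI [of _ 0] by (auto simp: const_polys_def)

lemma const_mult: "C \<in> const_polys \<Longrightarrow> D \<in> const_polys \<Longrightarrow> C * D \<in> const_polys"
  by (auto simp: const_polys_def mult_single)

lemma const_add: "C \<in> const_polys \<Longrightarrow> D \<in> const_polys \<Longrightarrow> C + D \<in> const_polys"
  by (auto simp: const_polys_def single_add [symmetric])

lemma const_uminus: "C \<in> const_polys \<Longrightarrow> - C \<in> const_polys"
  by (auto simp: const_polys_def single_uminus [symmetric])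

lemma const_rpoly: "rpoly [:a:] \<in> const_polys"
  using rpoly_monom [of a 0] by (simp add: const_polys_def monom_0)

lemma const_one: "1 \<in> const_polys" and const_zero: "0 \<in> const_polys"
  using const_rpoly [of 1] const_rpoly [of 0] by (simp_all flip: one_pCons)

lemma const_units: "qI \<in> const_polys" "qJ \<in> const_polys" "qK \<in> const_polys" "hyp \<in> const_polys" "swap \<in> const_polys"
proof -
  have "pgen a \<in> const_polys" for a by (simp add: pgen_def const_polys_def)
  then show "qI \<in> const_polys" "qJ \<in> const_polys" "qK \<in> const_polys" "hyp \<in> const_polys" "swap \<in> const_polys"
    unfolding unit_defs by (simp_all add: const_mult)
qed

lemma const_idem: "idem_p \<in> const_polys" "idem_m \<in> const_polys"
  using const_add [OF const_one const_uminus [OF const_units(4)]]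
  unfolding idem_p_def idem_m_def by (auto intro!: const_mult const_add const_rpoly const_one const_units)

lemma affine_mat: "a \<in> affine_polys \<Longrightarrow> b \<in> affine_polys \<Longrightarrow> c \<in> affine_polys \<Longrightarrow> d \<in> affine_polys \<Longrightarrow> mat a b c d \<in> affine_polys"
  unfolding mat_def by (intro affine_add affine_mult const_mult const_idem const_units)

lemma affine_rpoly: "rpoly [:a, b:] \<in> affine_polys"
proof -
  have "rpoly [:a, b:] = rpoly (monom a 0 + monom b 1)"
    by (simp add: monom_0 monom_Suc One_nat_def del: rpoly_simps)
  then show ?thesis
    by (simp only: rpoly_simps rpoly_monom affineI)
qed

lemma spinor_poly_rpoly: "f \<noteq> 0 \<Longrightarrow> spinor_poly (rpoly f)"
  by (rule spinor_polyI [of _ "f * f"]) (auto simp: rpoly_even)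

lemma linear_factorable: "spinor_poly L \<Longrightarrow> poly_degree L = 1 \<Longrightarrow> L \<in> factorable"
  unfolding factorable_def has_linear_factorization_def
  by (auto intro!: exI [of _ 1] exI [of _ "[L]"])

text \<open>A constant has no linear factors of its own, but \<open>t\<close> times it does.\<close>

lemma affine_factorable:
  assumes "spinor_poly L" "L \<in> affine_polys"
  shows "L \<in> factorable"
proof -
  obtain x y where L: "L = Poly_Mapping.single 0 x + Poly_Mapping.single 1 y"
    using assms(2) by (auto simp: affine_polys_def)
  have "L \<noteq> 0"
    using assms(1) by (auto simp: spinor_poly_def)
  show ?thesis
  proof (cases "y = 0")
    case True
    with L \<open>L \<noteq> 0\<close> have x: "L = Poly_Mapping.single 0 x" "x \<noteq> 0" by auto
    have "L * rpoly (monom 1 1) = Poly_Mapping.single 1 x"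
      by (simp add: x(1) rpoly_monom mult_single)
    moreover have "spinor_poly (L * rpoly (monom 1 1))"
      using assms(1) by (intro spinor_poly_mult spinor_poly_rpoly) auto
    ultimately have "rpoly (monom 1 1) * L \<in> factorable"
      using x(2) by (simp add: linear_factorable poly_degree_def rpoly_commute)
    then show ?thesis
      by (rule factorable_cancel) simp
  next
    case False
    \<comment> \<open>\<open>Poly_Mapping.degree\<close> is one too large, so the value 2 stands for
      a linear polynomial.\<close>
    have "Poly_Mapping.degree L \<le> 2"
      unfolding L using degree_add [of "Poly_Mapping.single 0 x" "Poly_Mapping.single 1 y"]
      by (cases "x = 0"; cases "y = 0") simp_all
    moreover have "1 < Poly_Mapping.degree L"
      using False by (intro in_keys_less_degree) (simp add: L in_keys_iff lookup_add lookup_single when_def)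
    ultimately have "poly_degree L = 1"
      by (simp add: poly_degree_def)
    with assms(1) show ?thesis by (rule linear_factorable)
  qed
qed

text \<open>The two groups of four equations compare the entries of
  \<open>C * poly_reverse C\<close> and of \<open>poly_reverse C * C\<close> with those of the
  scalar matrix \<open>rpoly r\<close>.\<close>

lemma spinor_mat:
  assumes "a \<in> quats" "b \<in> quats" "c \<in> quats" "d \<in> quats"
    and "a * poly_reverse d + b * poly_reverse c = rpoly r" "a * poly_reverse b + b * poly_reverse a = 0"
      "c * poly_reverse d + d * poly_reverse c = 0" "c * poly_reverse b + d * poly_reverse a = rpoly r"
    and "poly_reverse d * a + poly_reverse b * c = rpoly r" "poly_reverse d * b + poly_reverse b * d = 0"
      "poly_reverse c * a + poly_reverse a * c = 0" "poly_reverse c * b + poly_reverse a * d = rpoly r"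
    and "r \<noteq> 0"
  shows "spinor_poly (mat a b c d)"
  using assms by (intro spinor_polyI [of _ r]) (simp_all add: mat_even mat_reverse mat_mult flip: rpoly_eq_mat)


section \<open>Diagonal matrices with real entries\<close>

definition diag where "diag f g = mat (rpoly f) 0 0 (rpoly g)"
text \<open>For \<open>x\<close> in \<open>quats\<close> a spinor polynomial exactly if
  \<open>x\<close> is imaginary, with norm 1.\<close>

definition shear where "shear x = mat 1 x 0 1"

lemma affine_zero: "0 \<in> affine_polys" and affine_one: "1 \<in> affine_polys"
  by (simp_all add: const_affine const_zero const_one)

lemma quat_zero [simp]: "quat 0 0 0 0 = 0"
  by (simp add: quat_def)

lemma swap_factorable: "swap \<in> factorable"
  unfolding swap_eq_mat
  by (intro affine_factorable spinor_mat [where r = 1] affine_mat const_affine const_zero const_one) simp_all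

lemma qI_factorable: "qI \<in> factorable"
proof -
  have "spinor_poly (mat qI 0 0 qI)"
    by (rule spinor_mat [where r = 1]) simp_all
  then show ?thesis
    by (intro affine_factorable const_affine const_units) (simp flip: quat_eq_mat)
qed

lemma shear_affine_factorable:
  assumes "x \<in> quats" "poly_reverse x = - x" "x \<in> affine_polys"
  shows "shear x \<in> factorable"
  unfolding shear_def using assms
  by (intro affine_factorable spinor_mat [where r = 1] affine_mat affine_zero affine_one) simp_all

lemma diag_affine_factorable:
  assumes "f \<noteq> 0" "g \<noteq> 0" "rpoly f \<in> affine_polys" "rpoly g \<in> affine_polys"
  shows "diag f g \<in> factorable"
  unfolding diag_def using assms
  by (intro affine_factorable spinor_mat [where r = "f * g"] affine_mat affine_zero)
    (simp_all add: mult.commute flip: rpoly_mult)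

lemma scale_mat: "x * mat a b c d = mat (x * a) (x * b) (x * c) (x * d)"
  by (simp add: mat_def distrib_left mult.assoc)

lemma quat_uminus: "- quat a b c d = quat (- a) (- b) (- c) (- d)"
  by (simp add: quat_def)

lemma diag_mult: "diag f g * diag f' g' = diag (f * f') (g * g')"
  by (simp add: diag_def mat_mult)

lemma swap_diag_swap: "swap * diag f g * swap = diag g f"
  by (simp add: diag_def swap_eq_mat mat_mult)

text \<open>Treats a pair of conjugate roots: the diagonal matrix is obtained from one linear spinor
  polynomial of this norm and further factors of degree at most one.\<close>

lemma diag_quadratic:
  fixes b :: real
  assumes "b \<noteq> 0"
  shows "diag ([:- a, 1:]\<^sup>2 + [:b\<^sup>2:]) 1 \<in> factorable"
proof -
  define s B k where "s = [:- a, 1:]" and "B = [:b:]" and "k = [:1 / b:]"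
  have kB: "k * B = 1" and B0: "B \<noteq> 0" and k0: "k \<noteq> 0"
    using assms by (simp_all add: k_def B_def)
  have sB0: "s * s + B * B \<noteq> 0"
  proof
    assume "s * s + B * B = 0"
    then have "poly (s * s + B * B) a = 0" by simp
    then show False using assms by (simp add: s_def B_def)
  qed
  define L where "L = mat (quat s 0 0 0) (quat 0 B 0 0) (quat 0 B 0 0) (quat s 0 0 0)"
  \<comment> \<open>As \<open>k * B = 1\<close>, multiplying \<open>L\<close> by \<open>T\<close>
    from the left clears the upper left entry, and from the right the lower right one.\<close>
  define T where "T = shear (quat 0 (k * s) 0 0)"
  have quat: "quat f g 0 0 = rpoly f + rpoly g * qI" for f g
    by (simp add: quat_def)
  have aff: "rpoly s \<in> affine_polys" "rpoly (k * s) \<in> affine_polys" "rpoly B \<in> affine_polys" "rpoly B \<in> const_polys"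
    by (simp_all add: s_def k_def B_def affine_rpoly const_affine const_rpoly del: rpoly_mult)
  have "L \<in> factorable"
    unfolding L_def
  proof (intro affine_factorable affine_mat spinor_mat [where r = "s * s + B * B"])
    show "quat s 0 0 0 \<in> affine_polys" "quat 0 B 0 0 \<in> affine_polys" 
      using aff by (auto simp: quat intro: affine_mult const_units)
    then show "quat s 0 0 0 \<in> affine_polys" "quat 0 B 0 0 \<in> affine_polys" .
  qed (use sB0 in \<open>simp_all add: quat_mult quat_reverse quat_add rpoly_eq_quat add.commute del: rpoly_simps rpoly_mult\<close>)
  moreover have "T \<in> factorable"
    unfolding T_def using aff
    by (intro shear_affine_factorable) (auto simp: quat poly_reverse_mult rpoly_commute intro: affine_mult const_units simp del: rpoly_mult)
  moreover have "T * L * T = qI * diag (B + k * s\<^sup>2) B * swap"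
  proof -
    have ksB: "k * (B * s) = s" "k * (s * B) = s"
      using kB by (metis mult.assoc mult.commute mult_1_right)+
    have "T * L * T = mat 0 (quat 0 (B + k * s\<^sup>2) 0 0) (quat 0 B 0 0) 0"
      unfolding T_def L_def shear_def rpoly_eq_quat [of 1, simplified]
      by (simp add: mat_mult quat_mult quat_add mult.assoc power2_eq_square mult.left_commute [of B k] ksB)
    also have "\<dots> = qI * diag (B + k * s\<^sup>2) B * swap"
      by (simp add: diag_def quat scale_mat [of qI] swap_eq_mat mat_mult rpoly_commute [of qI] del: rpoly_simps(3) rpoly_mult)
    finally show ?thesis .
  qed
  ultimately have "qI * diag (B + k * s\<^sup>2) B * swap \<in> factorable"
    by (metis factorable_mult)
  \<comment> \<open>The additional \<open>qI\<close> and \<open>swap\<close> cancel those present up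
    to the sign -1, and \<open>diag B k\<close> clears the denominator \<open>B\<close> and makes
    the second entry 1.\<close>
  then have "qI * (qI * diag (B + k * s\<^sup>2) B * swap) * swap * diag B k \<in> factorable"
    using aff k0 B0 factorable_mult [OF factorable_mult [OF factorable_mult [OF qI_factorable] swap_factorable] diag_affine_factorable]
    by (simp add: k_def const_affine const_rpoly)
  moreover have "qI * (qI * diag (B + k * s\<^sup>2) B * swap) * swap * diag B k = rpoly (-1) * diag (s\<^sup>2 + B\<^sup>2) 1"
  proof -
    have "qI * (qI * diag (B + k * s\<^sup>2) B * swap) * swap * diag B k = (qI * qI) * diag (B + k * s\<^sup>2) B * (swap * swap) * diag B k"
      by (simp only: mult.assoc)
    also have "\<dots> = rpoly (-1) * diag ((B + k * s\<^sup>2) * B) (B * k)"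
      by (simp add: mult.assoc diag_mult del: rpoly_mult)
    also have "(B + k * s\<^sup>2) * B = s\<^sup>2 + B\<^sup>2"
      using kB by (simp add: algebra_simps power2_eq_square)
    finally show ?thesis
      using kB by (simp add: mult.commute)
  qed
  ultimately have "diag (s\<^sup>2 + B\<^sup>2) 1 \<in> factorable"
    by (metis factorable_cancel neg_equal_0_iff_equal zero_neq_one)
  then show ?thesis
    by (simp add: s_def B_def power2_eq_square)
qed

section \<open>Complex roots and factors of real polynomials\<close>

lemma poly_map_poly_of_real: "poly (map_poly complex_of_real p) (of_real x) = of_real (poly p x)"
  by (induction p) (simp_all add: map_poly_pCons)

lemma poly_map_poly_of_real_add:
  "poly (map_poly complex_of_real (p + q)) z =
    poly (map_poly of_real p) z + poly (map_poly of_real q) z"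
proof -
  have "map_poly complex_of_real (p + q) = map_poly of_real p + map_poly of_real q"
    by (rule poly_eqI) (simp add: coeff_map_poly)
  then show ?thesis by simp
qed

lemma poly_map_poly_of_real_mult:
  "poly (map_poly complex_of_real (p * q)) z =
    poly (map_poly of_real p) z * poly (map_poly of_real q) z"
  by (induction p) (simp_all add: map_poly_pCons map_poly_smult poly_map_poly_of_real_add algebra_simps)

text \<open>Induction on the degree: a complex root of \<open>f\<close> yields a real factor of
  degree one or two, which splits off since diagonal matrices multiply entrywise.\<close>

lemma diag_factorable_aux: "f \<noteq> 0 \<Longrightarrow> diag f 1 \<in> factorable"
proof (induction "degree f" arbitrary: f rule: less_induct)
  case less
  have lin: "diag [:c, d:] 1 \<in> factorable" if "[:c, d:] \<noteq> 0" for c d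
    using that const_one by (intro diag_affine_factorable) (auto simp: affine_rpoly const_affine)
  show ?case
  proof (cases "degree f = 0")
    case True
    then obtain c where "f = [:c, 0:]" by (metis degree_eq_zeroE pCons_0_0)
    with lin less.prems show ?thesis by blast
  next
    case False
    have step: ?thesis if "f = g * h" "diag g 1 \<in> factorable" "degree g > 0" for g h
    proof -
      have "g \<noteq> 0" "h \<noteq> 0" using that(1) less.prems by auto
      with that(1,3) have "degree h < degree f" by (simp add: degree_mult_eq)
      with less.hyps \<open>h \<noteq> 0\<close> have "diag h 1 \<in> factorable" by blast
      with that(2) have "diag g 1 * diag h 1 \<in> factorable" by (rule factorable_mult)
      then show ?thesis by (simp add: diag_mult that(1))
    qed
    let ?F = "map_poly complex_of_real f"
    have "\<not> constant (poly ?F)"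
      using False by (simp add: constant_degree degree_map_poly)
    then obtain z where z: "poly ?F z = 0"
      using fundamental_theorem_of_algebra by blast
    show ?thesis
    proof (cases "Im z = 0")
      case True
      then have "z = of_real (Re z)" by (simp add: complex_eq_iff)
      with z have "complex_of_real (poly f (Re z)) = 0"
        by (metis poly_map_poly_of_real)
      then have "poly f (Re z) = 0"
        by simp
      then obtain h where "f = [:- Re z, 1:] * h"
        by (metis dvdE poly_eq_0_iff_dvd)
      then show ?thesis
        by (rule step) (use lin in auto)
    next
      case False
      \<comment> \<open>The monic real quadratic whose roots are \<open>z\<close> and its
        conjugate.\<close>
      define g where "g = [:- Re z, 1:]\<^sup>2 + [:(Im z)\<^sup>2:]"
      have g: "g = [:(Re z)\<^sup>2 + (Im z)\<^sup>2, - 2 * Re z, 1:]"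
        by (simp add: g_def power2_eq_square)
      have "degree g = 2" by (simp add: g)
      have gz: "poly (map_poly complex_of_real g) z = 0"
        by (simp add: g complex_eq_iff power2_eq_square algebra_simps map_poly_pCons)
      \<comment> \<open>The remainder is real of degree at most one and vanishes at the nonreal
        \<open>z\<close>, so it is zero.\<close>
      define r where "r = f mod g"
      have "degree r < 2"
        using degree_mod_less [of g f] \<open>degree g = 2\<close> by (cases "g = 0"; cases "r = 0") (auto simp: r_def)
      then have "r = [:coeff r 0, coeff r 1:]"
        by (intro poly_eqI) (auto simp: coeff_pCons coeff_eq_0 split: nat.split)
      then obtain c d where r: "r = [:c, d:]"
        by blast
      have "map_poly complex_of_real f = map_poly complex_of_real (f div g * g + r)"
        by (simp add: r_def)
      then have "poly (map_poly complex_of_real r) z = 0"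
        using z gz by (simp only: poly_map_poly_of_real_add poly_map_poly_of_real_mult) simp
      then have "c + d * Re z = 0" "d * Im z = 0"
        by (auto simp: r complex_eq_iff map_poly_pCons mult.commute)
      with False have "r = 0" by (auto simp: r)
      then obtain h where "f = g * h"
        unfolding r_def by (metis dvdE mod_eq_0_iff_dvd)
      then show ?thesis
        by (rule step) (use diag_quadratic [OF False] \<open>degree g = 2\<close> in \<open>auto simp: g_def\<close>)
    qed
  qed
qed

text \<open>Conjugation by \<open>swap\<close> moves the entry \<open>g\<close> of
  \<open>diag g 1\<close> to the other corner.\<close>

lemma diag_factorable: "f \<noteq> 0 \<Longrightarrow> g \<noteq> 0 \<Longrightarrow> diag f g \<in> factorable"
proof -
  assume "f \<noteq> 0" "g \<noteq> 0"
  then have "diag f 1 * (swap * diag g 1 * swap) \<in> factorable"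
    by (intro factorable_mult swap_factorable diag_factorable_aux)
  then show ?thesis by (simp add: swap_diag_swap diag_mult)
qed


section \<open>Bruhat decomposition\<close>

lemma shear_add: "x \<in> quats \<Longrightarrow> y \<in> quats \<Longrightarrow> shear x * shear y = shear (x + y)"
  by (simp add: shear_def mat_mult add.commute)

text \<open>\<open>diag 1 f\<close> is \<open>f\<close> times the inverse of
  \<open>diag f 1\<close>, so conjugation by the latter works without denominators.\<close>

lemma shear_rpoly_factorable:
  assumes "e \<in> quats" "poly_reverse e = - e" "e \<in> const_polys"
  shows "shear (rpoly f * e) \<in> factorable"
proof (cases "f = 0")
  case True
  then show ?thesis
    using shear_affine_factorable [of 0] by (simp add: affine_zero)
next
  case False
  have "diag f 1 * shear e * diag 1 f = rpoly f * shear (rpoly f * e)"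
    using assms(1) by (simp add: diag_def shear_def mat_mult scale_mat [of "rpoly f"] rpoly_commute [of "rpoly f * e"])
  moreover have "diag f 1 * shear e * diag 1 f \<in> factorable"
    using False assms by (intro factorable_mult diag_factorable shear_affine_factorable const_affine) simp_all
  ultimately show ?thesis
    using factorable_cancel False by metis
qed

text \<open>Entries of unipotent matrices add under multiplication, so the three imaginary
  components can be treated one by one.\<close>

lemma shear_factorable: "shear (quat 0 b c d) \<in> factorable"
proof -
  have "shear (rpoly b * qI) * (shear (rpoly c * qJ) * shear (rpoly d * qK)) \<in> factorable"
    by (intro factorable_mult shear_rpoly_factorable) (simp_all add: const_units)
  moreover have "shear (rpoly b * qI) * (shear (rpoly c * qJ) * shear (rpoly d * qK)) = shear (quat 0 b c d)"
    by (simp add: shear_add quat_def add.assoc)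
  ultimately show ?thesis by simp
qed

text \<open>This is \<open>n\<close> times the unipotent matrix whose entry is the given quaternion
  divided by \<open>n\<close>.\<close>

lemma upper_factorable:
  assumes "n \<noteq> 0"
  shows "mat (rpoly n) (quat 0 b c d) 0 (rpoly n) \<in> factorable"
proof -
  have "diag 1 n * shear (quat 0 b c d) * diag n 1 \<in> factorable"
    using assms by (intro factorable_mult diag_factorable shear_factorable) simp_all
  then show ?thesis
    by (simp add: diag_def shear_def mat_mult)
qed

lemma lower_factorable:
  assumes "n \<noteq> 0"
  shows "mat (rpoly n) 0 (quat 0 b c d) (rpoly n) \<in> factorable"
proof -
  have "swap * mat (rpoly n) (quat 0 b c d) 0 (rpoly n) * swap \<in> factorable"
    using assms by (intro factorable_mult upper_factorable swap_factorable)
  then show ?thesis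
    by (simp add: swap_eq_mat mat_mult)
qed

text \<open>The product of unipotent matrices with upper entry x, lower entry -1/x and upper entry x
  is antidiagonal. Here \<open>x * x\<close> is -n, so that -1/x = x/n is imaginary again.\<close>

lemma imaginary_factorable:
  assumes "quat 0 b c d \<noteq> 0"
  shows "quat 0 b c d \<in> factorable"
proof -
  define x n where "x = quat 0 b c d" and "n = b * b + c * c + d * d"
  have x: "x \<in> quats" by (simp add: x_def)
  have xx: "x * x = - rpoly n"
    by (simp add: x_def n_def quat_mult rpoly_eq_quat quat_uminus add.commute del: rpoly_simps rpoly_mult)
  have "n \<noteq> 0"
    using assms sum_squares_poly_eq_0 [of 0 b c d] by (auto simp: n_def power2_eq_square)
  have "shear x * mat (rpoly n) 0 x (rpoly n) * shear x = x * (diag n 1 * swap)"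
    using x by (simp add: shear_def diag_def mat_mult xx scale_mat [of x] swap_eq_mat rpoly_commute [of x])
  moreover have "shear x * mat (rpoly n) 0 x (rpoly n) * shear x \<in> factorable"
    unfolding x_def using \<open>n \<noteq> 0\<close> by (intro factorable_mult shear_factorable lower_factorable)
  \<comment> \<open>The two \<open>swap\<close> cancel and the diagonal matrices combine to the
    scalar \<open>n\<close>.\<close>
  ultimately have "x * (diag n 1 * swap) * (swap * diag 1 n) \<in> factorable"
    using \<open>n \<noteq> 0\<close> factorable_mult [OF _ factorable_mult [OF swap_factorable diag_factorable]] by simp
  also have "x * (diag n 1 * swap) * (swap * diag 1 n) = x * (diag n 1 * (swap * swap) * diag 1 n)"
    by (simp only: mult.assoc)
  also have "\<dots> = rpoly n * x"
    by (simp add: diag_mult) (simp add: diag_def rpoly_commute [of x] flip: rpoly_eq_mat)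
  finally show ?thesis
    unfolding x_def by (rule factorable_cancel) fact
qed

text \<open>A quaternion \<open>x\<close> is up to a real factor the product of imaginary ones: if \<open>y\<close> is imaginary
  and orthogonal to the imaginary part of \<open>x\<close>, then \<open>y * x\<close> is imaginary, too.\<close>

lemma quats_factorable:
  assumes "x \<in> quats" "x \<noteq> 0"
  shows "x \<in> factorable"
proof -
  from assms(1) obtain a b c d where x: "x = quat a b c d" by (rule quatsE)
  \<comment> \<open>The vector (p, q, 0) is nonzero and orthogonal to (b, c, d).\<close>
  obtain p q where pq: "p * b + q * c = 0" "p \<noteq> 0 \<or> q \<noteq> 0"
  proof (cases "b = 0")
    case True
    then show thesis using that [of 1 0] by simp
  next
    case False
    then show thesis using that [of "- c" b] by simp
  qed
  define y where "y = quat 0 p q 0"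
  define n where "n = p * p + q * q"
  have "n \<noteq> 0"
    using pq(2) unfolding n_def sum_squares_eq_zero_iff by blast
  have yy: "y * y = rpoly (- n)"
    by (simp add: y_def n_def quat_mult rpoly_eq_quat add.commute del: rpoly_simps rpoly_mult)
  have "y \<noteq> 0"
  proof
    assume "y = 0"
    then have "rpoly (- n) = 0" by (simp only: flip: yy) simp
    with \<open>n \<noteq> 0\<close> show False unfolding rpoly_eq_0_iff by simp
  qed
  have yx: "y * x = quat 0 (p * a + q * d) (q * a - p * d) (p * c - q * b)"
  proof -
    have "- (p * b) - q * c = - (p * b + q * c)"
      by simp
    with pq(1) have "- (p * b) - q * c = 0"
      by simp
    then show ?thesis
      by (simp add: x y_def quat_mult)
  qed
  \<comment> \<open>\<open>y\<close> is its own inverse up to the real factor -n, so multiplying by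
    it once more recovers \<open>x\<close>.\<close>
  have yyx: "y * (y * x) = rpoly (- n) * x"
    using yy by (simp flip: mult.assoc)
  have "y * x \<noteq> 0"
  proof
    assume "y * x = 0"
    then have "rpoly (- n) * x * poly_reverse x = 0"
      using yyx by simp
    moreover obtain m where "x * poly_reverse x = rpoly m" "m \<noteq> 0"
      using quats_norm [OF assms(1)] assms(2) by metis
    ultimately have "rpoly (- n * m) = 0"
      by (simp add: mult.assoc)
    with \<open>n \<noteq> 0\<close> \<open>m \<noteq> 0\<close> show False
      by (simp del: rpoly_mult)
  qed
  then have "y * (y * x) \<in> factorable"
    using \<open>y \<noteq> 0\<close> unfolding yx by (intro factorable_mult) (auto simp: y_def intro: imaginary_factorable)
  then show ?thesis
    unfolding yyx using \<open>n \<noteq> 0\<close> by (intro factorable_cancel [of "- n" x]) simp_all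
qed

lemma poly_reverse_poly_reverse [simp]: "poly_reverse (poly_reverse C) = C"
proof -
  have "reverse (reverse x) = x" for x
    by (rule cga_eqI) (simp flip: mult.assoc power_mult_distrib)
  then show ?thesis
    by (intro poly_mapping_eqI) simp
qed

section \<open>Reduction of spinor polynomials to antidiagonal form\<close>

lemma upper_spinor:
  assumes "x \<in> quats" "poly_reverse x = - x" "n \<noteq> 0"
  shows "spinor_poly (mat (rpoly n) x 0 (rpoly n))" "mat (rpoly n) x 0 (rpoly n) \<in> factorable"
proof -
  show "spinor_poly (mat (rpoly n) x 0 (rpoly n))"
    using assms rpoly_commute [of x n] by (intro spinor_mat [where r = "n * n"]) simp_all
  show "mat (rpoly n) x 0 (rpoly n) \<in> factorable"
    using assms(3) quats_imaginary [OF assms(1,2)] upper_factorable by metis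
qed

text \<open>The spinor condition makes the entries proportional: with norm \<open>r\<close> of the
  matrix and norm \<open>m\<close> of \<open>c\<close> it gives m b = r c. Hence \<open>c\<close>
  splits off as a scalar and a real matrix remains.\<close>

lemma antidiagonal_factorable:
  assumes "b \<in> quats" "c \<in> quats" "spinor_poly (mat 0 b c 0)"
  shows "mat 0 b c 0 \<in> factorable"
proof -
  obtain r where "mat 0 b c 0 * poly_reverse (mat 0 b c 0) = rpoly r" "r \<noteq> 0"
    using assms(3) by (rule spinor_polyE)
  with assms(1,2) have "mat (b * poly_reverse c) 0 0 (c * poly_reverse b) = mat (rpoly r) 0 0 (rpoly r)"
    by (simp add: mat_reverse mat_mult flip: rpoly_eq_mat)
  with assms(1,2) have bc: "b * poly_reverse c = rpoly r"
    by (subst (asm) mat_eq_iff) simp_all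
  with \<open>r \<noteq> 0\<close> have "c \<noteq> 0"
    by auto
  with assms(2) obtain m where m: "poly_reverse c * c = rpoly m" "m \<noteq> 0"
    using quats_norm by metis
  have "b * rpoly m = rpoly r * c"
    by (simp flip: m bc) (simp add: mult.assoc)
  then have "rpoly m * mat 0 b c 0 = c * diag r m * swap"
    using rpoly_commute [of b m] rpoly_commute [of c]
    by (simp add: diag_def swap_eq_mat mat_mult scale_mat [of "rpoly m"] scale_mat [of c])
  moreover have "c * diag r m * swap \<in> factorable"
    using assms(2) \<open>c \<noteq> 0\<close> \<open>r \<noteq> 0\<close> \<open>m \<noteq> 0\<close>
    by (intro factorable_mult quats_factorable diag_factorable swap_factorable)
  ultimately show ?thesis
    using \<open>m \<noteq> 0\<close> by (metis factorable_cancel)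
qed

text \<open>The big cell of the Bruhat decomposition: as \<open>c\<close> is nonzero, unipotent
  factors with entries -a/c on the left and -c^(-1) d on the right clear the diagonal.\<close>

lemma spinor_mat_factorable:
  assumes "a \<in> quats" "b \<in> quats" "c \<in> quats" "d \<in> quats" "c \<noteq> 0" "spinor_poly (mat a b c d)"
  shows "mat a b c d \<in> factorable"
proof -
  let ?rev = poly_reverse and ?P = "mat a b c d"
  note quats = assms(1-4)
  obtain r where PP: "?P * ?rev ?P = rpoly r" "?rev ?P * ?P = rpoly r"
    using assms(6) by (rule spinor_polyE)
  from PP(1) have "?P * ?rev ?P = mat (rpoly r) 0 0 (rpoly r)"
    by (simp flip: rpoly_eq_mat)
  with quats have cd: "c * ?rev d = - (d * ?rev c)"
    by (simp add: mat_reverse mat_mult mat_eq_iff eq_neg_iff_add_eq_0)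
  from PP(2) have "?rev ?P * ?P = mat (rpoly r) 0 0 (rpoly r)"
    by (simp flip: rpoly_eq_mat)
  with quats have ca: "?rev a * c = - (?rev c * a)"
    by (simp add: mat_reverse mat_mult mat_eq_iff eq_neg_iff_add_eq_0 add.commute)
  obtain n where n: "c * ?rev c = rpoly n" "?rev c * c = rpoly n" "n \<noteq> 0"
    using quats_norm [OF quats(3)] assms(5) by metis
  \<comment> \<open>\<open>X\<close> is a c^(-1) and \<open>Y\<close> is c^(-1) d, both times n^2.
    In this form they are conjugates of \<open>?rev c * a\<close> and \<open>d * ?rev c\<close>,
    which are imaginary by \<open>ca\<close> and \<open>cd\<close>.\<close>
  define X where "X = c * (?rev c * a) * ?rev c"
  define Y where "Y = ?rev c * (d * ?rev c) * c"
  define k where "k = n * n"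
  have X: "X \<in> quats" "?rev X = - X" and Y: "Y \<in> quats" "?rev Y = - Y"
    using quats by (simp_all add: X_def Y_def poly_reverse_mult poly_reverse_poly_reverse ca cd mult.assoc)
  have "k \<noteq> 0" using n(3) by (simp add: k_def)
  have "X * c = (c * ?rev c) * a * (?rev c * c)"
    by (simp only: X_def mult.assoc)
  then have Xc: "X * c = rpoly k * a"
    using rpoly_commute [of a n] by (simp add: n k_def mult.assoc)
  have "c * Y = (c * ?rev c) * d * (?rev c * c)"
    by (simp only: Y_def mult.assoc)
  then have cY: "c * Y = rpoly k * d"
    using rpoly_commute [of d n] by (simp add: n k_def mult.assoc)
  define Q where "Q = mat (rpoly k) (- X) 0 (rpoly k)"
  define S where "S = mat (rpoly k) (- Y) 0 (rpoly k)"
  have QS: "spinor_poly Q" "spinor_poly S"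
    using X Y \<open>k \<noteq> 0\<close> unfolding Q_def S_def by (auto intro: upper_spinor)
  \<comment> \<open>The reverses invert \<open>Q\<close> and \<open>S\<close> up to a real factor
    and are of the same shape, so \<open>Q\<close> and \<open>S\<close> can be removed
    again.\<close>
  have rev: "?rev Q \<in> factorable" "?rev S \<in> factorable"
    "?rev Q * Q = rpoly (k * k)" "S * ?rev S = rpoly (k * k)"
    using X Y \<open>k \<noteq> 0\<close> rpoly_commute [of X k] rpoly_commute [of Y k]
    by (simp_all add: Q_def S_def mat_reverse mat_mult upper_spinor flip: rpoly_eq_mat rpoly_mult)
  have "Q * ?P = mat 0 (rpoly k * b - X * d) (rpoly k * c) (rpoly k * d)"
    using quats X by (simp add: Q_def mat_mult Xc)
  moreover have "rpoly k * c * Y = rpoly k * d * rpoly k"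
    using rpoly_commute [of "rpoly k * d" k] by (simp add: mult.assoc cY)
  ultimately have QPS: "Q * ?P * S = mat 0 ((rpoly k * b - X * d) * rpoly k) (rpoly k * c * rpoly k) 0"
    using quats Y by (simp add: S_def mat_mult)
  have "spinor_poly (Q * ?P * S)"
    using QS assms(6) by (intro spinor_poly_mult)
  then have "Q * ?P * S \<in> factorable"
    using quats X unfolding QPS by (intro antidiagonal_factorable) simp_all
  then have "?rev Q * (Q * ?P * S) * ?rev S \<in> factorable"
    by (intro factorable_mult [OF factorable_mult [OF rev(1)] rev(2)])
  also have "?rev Q * (Q * ?P * S) * ?rev S = (?rev Q * Q) * ?P * (S * ?rev S)"
    by (simp only: mult.assoc)
  also have "\<dots> = rpoly (k * k * (k * k)) * ?P"
    by (simp only: rev rpoly_mult [of "k * k" "k * k"] mult.assoc [of "rpoly (k * k)"]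
        rpoly_commute [of ?P "k * k"])
  finally show ?thesis
    by (rule factorable_cancel) (use \<open>k \<noteq> 0\<close> in simp)
qed

text \<open>If the lower left entry vanishes, \<open>swap\<close> exchanges the rows and puts
  \<open>a\<close> in its place.\<close>

lemma spinor_poly_factorable:
  assumes "spinor_poly P"
  shows "P \<in> factorable"
proof -
  obtain r where "P \<in> even_polys" and r: "P * poly_reverse P = rpoly r" "r \<noteq> 0"
    using assms by (rule spinor_polyE)
  from this(1) obtain a b c d where quats: "a \<in> quats" "b \<in> quats" "c \<in> quats" "d \<in> quats"
    and P: "P = mat a b c d"
    by (rule even_poly_eq_mat)
  show ?thesis
  proof (cases "c = 0")
    case False
    with assms quats show ?thesis unfolding P by (intro spinor_mat_factorable)
  next
    case True
    have WP: "swap * P = mat c d a b"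
      using quats by (simp add: P swap_eq_mat mat_mult)
    have "spinor_poly swap"
      unfolding swap_eq_mat by (rule spinor_mat [where r = 1]) simp_all
    then have "spinor_poly (swap * P)"
      using assms by (rule spinor_poly_mult)
    \<comment> \<open>With a vanishing first column the norm of \<open>P\<close> would be
      zero.\<close>
    moreover have "a \<noteq> 0"
    proof
      assume "a = 0"
      then have "P * poly_reverse P = mat (b * 0) (b * 0) (d * 0) (d * poly_reverse a)"
        using quats True by (simp add: P mat_reverse mat_mult)
      with r quats \<open>a = 0\<close> show False by (simp add: mat_def)
    qed
    ultimately have "swap * P \<in> factorable"
      using quats unfolding WP by (intro spinor_mat_factorable)
    then have "swap * (swap * P) \<in> factorable"
      by (rule factorable_mult [OF swap_factorable])
    moreover have "swap * (swap * P) = P"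
      by (simp flip: mult.assoc)
    ultimately show ?thesis
      by simp
  qed
qed

theorem corollary2:
  fixes P :: cga_poly
  assumes "spinor_poly P"
  shows "(\<exists>H. spinor_poly H \<and> has_linear_factorization (P * H)) \<and>
    (\<exists>R\<in>real_polys. R \<noteq> 0 \<and> has_linear_factorization (P * R))"
proof -
  obtain f where f: "f \<noteq> 0" "has_linear_factorization (P * rpoly f)"
    using spinor_poly_factorable [OF assms] by (auto simp: factorable_def)
  \<comment> \<open>\<open>rpoly f\<close> serves as both \<open>H\<close> and \<open>R\<close>: it
    equals its reverse, so its norm is the square of \<open>f\<close>.\<close>
  then have "spinor_poly (rpoly f)" "rpoly f \<in> real_polys" "rpoly f \<noteq> 0"
    by (auto simp: spinor_poly_rpoly real_polys_eq)
  with f(2) show ?thesis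
    by blast
qed

end
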